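(* Let $A$ be a triassociative algebra over a field $K$ and $M$ an $A$-representation. The assignments $$\mathrm{Ext}(A,M)\to H^2_{\mathrm{Trias}}(A,M),\quad [\xi]\mapsto[f_\xi],\qquad\qquad H^2_{\mathrm{Trias}}(A,M)\to\mathrm{Ext}(A,M),\quad [g]\mapsto[\zeta_g]$$ are well-defined maps that are inverse to each other. In particular, there is a canonical bijection $H^2_{\mathrm{Trias}}(A,M)\cong\mathrm{Ext}(A,M)$.
   Context: All vector spaces and tensor products are over a fixed field $K$. A triassociative algebra is a vector space $A$ with three bilinear operations $\dashv,\vdash,\bot$ satisfying for all $x,y,z$: (1) $(x\dashv y)\dashv z=x\dashv(y\dashv z)$; (2) $(x\dashv y)\dashv z=x\dashv(y\vdash z)$; (3) $(x\vdash y)\dashv z=x\vdash(y\dashv z)$; (4) $(x\dashv y)\vdash z=x\vdash(y\vdash z)$; (5) $(x\vdash y)\vdash z=x\vdash(y\vdash z)$; (6) $(x\dashv y)\dashv z=x\dashv(y\,\bot\, z)$; (7) $(x\,\bot\, y)\dashv z=x\,\bot\,(y\dashv z)$; (8) $(x\dashv y)\,\bot\, z=x\,\bot\,(y\vdash z)$; (9) $(x\vdash y)\,\bot\, z=x\vdash(y\,\bot\, z)$; (10) $(x\,\bot\, y)\vdash z=x\vdash(y\vdash z)$; (11) $(x\,\bot\, y)\,\bot\, z=x\,\bot\,(y\,\bot\, z)$. Morphisms are linear maps respecting the three products. An $A$-representation is a vector space $M$ with bilinear left operations $\dashv,\vdash,\bot\colon A\otimes M\to M$ and right operations $\dashv,\vdash,\bot\colon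 M\otimes A\to M$ satisfying (1)-(11) whenever exactly one of $x,y,z$ is from $M$ and the other two are from $A$. Trees. $T_n$ ($n\ge0$) is the set of planar rooted trees with $n+1$ leaves in which every internal vertex has at least $2$ incoming edges ($T_0=\{|\}$, no internal vertex); $\psi\in T_n$ has degree $|\psi|=n$; leaves are numbered $0,\dots,n$ from left to right. The grafting $\psi_0\vee\cdots\vee\psi_k$ is obtained by arranging the trees from left to right and joining their roots to a new lowest internal vertex, connected to a new root; every tree of degree $\ge 1$ is uniquely of this form with $k\ge1$. A leaf is left (resp. right) oriented if it is the leftmost (resp. rightmost) incoming edge of the vertex it is attached to; otherwise it is a middle leaf. $d_i\colon T_{n+1}\to T_n$ deletes the $i$th leaf (suppressing any vertex left with one incoming edge). For $\psi=\psi_0\vee\cdots\vee\psi_k\in T_{n+1}$ and $0\le i\le n+1$ define $\circ_i^\psi\in\{\dashv,\vdash,\bot\}$ by: $\circ_0^\psi$ is $\dashv$ if $|\psi_0|=0$ and $k=1$; $\vdash$ if $|\psi_0|>0$; $\bot$ if $|\psi_0|=0$ and $k>1$. For $1\le i\le n$, $\circ_i^\psi$ is $\dashv$, $\vdash$, or $\bot$ according as the $i$th leaf is left oriented, right oriented, or a middle leaf. $\circ_{n+1}^\psi$ is $\dashv$ if $|\psi_k|>0$; $\vdash$ if $k=1$ and $|\psi_1|=0$; $\bot$ if $k>1$ and $|\psi_k|=0$. Cohomology. $C^n_{\mathrm{Trias}}(A,M)=\mathrm{Hom}_K(K[T_n]\otimes A^{\otimes n},M)$ for $n\ge 0$, with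 coboundary $\delta^n=\sum_{i=0}^{n+1}(-1)^i\delta_i^n\colon C^n_{\mathrm{Trias}}(A,M)\to C^{n+1}_{\mathrm{Trias}}(A,M)$, where for $\psi\in T_{n+1}$, $a_1,\dots,a_{n+1}\in A$: $(\delta_0^nf)(\psi;a_1,\dots,a_{n+1})=a_1\circ_0^\psi f(d_0\psi;a_2,\dots,a_{n+1})$; $(\delta_i^nf)(\psi;a_1,\dots,a_{n+1})=f(d_i\psi;a_1,\dots,a_i\circ_i^\psi a_{i+1},\dots,a_{n+1})$ for $1\le i\le n$; $(\delta_{n+1}^nf)(\psi;a_1,\dots,a_{n+1})=f(d_{n+1}\psi;a_1,\dots,a_n)\circ_{n+1}^\psi a_{n+1}$. This is a cochain complex, and $H^n_{\mathrm{Trias}}(A,M)$ is its $n$th cohomology. Extensions. A triassociative algebra is abelian if all three products are $0$; any vector space is regarded as an abelian triassociative algebra with zero products. If $0\to P\xrightarrow{i}E\xrightarrow{\pi}A\to0$ is a short exact sequence of triassociative algebras with $P$ abelian, then $P$ has an induced $A$-representation structure $a\ast p=e\ast i(p)$, $p\ast a=i(p)\ast e$ for any $e\in E$ with $\pi(e)=a$ (identifying $P$ with $i(P)$). An abelian extension of $A$ by $M$ is a short exact sequence $\xi\colon 0\to M\xrightarrow{i}E\xrightarrow{\pi}A\to0$ of triassociative algebras in which $M$ is abelian and the induced $A$-representation structure on $M$ coincides with the given one. Two abelian extensions $\xi,\xi'$ (with middle terms $E,E'$) are equivalent if there is a triassociative algebra map $E\to E'$ commuting with the maps from $M$ and to $A$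 (identities on $M$ and $A$). $[\xi]$ is the equivalence class and $\mathrm{Ext}(A,M)$ the set of equivalence classes. The three trees in $T_2$ are identified with the products: $|\vee(|\vee|)\leftrightarrow\dashv$, $(|\vee|)\vee|\leftrightarrow\vdash$, $|\vee|\vee|\leftrightarrow\bot$. Given $\xi$, choose a linear splitting $\sigma\colon A\to E$ of $\pi$ and identify $E$ with $M\oplus A$ via $(m,a)\leftrightarrow i(m)+\sigma(a)$; then $f_\xi\colon K[T_2]\otimes A^{\otimes2}\to M$ is the map for which the products of $E$ are $(m,a)\ast(n,b)=(m\ast b+a\ast n+f_\xi(\psi;a,b),\,a\ast b)$, where $\psi\in T_2$ corresponds to $\ast$; it is a $2$-cocycle. Given a $2$-cocycle $g\in C^2_{\mathrm{Trias}}(A,M)$, $\zeta_g$ is the abelian extension $0\to M\to M\oplus A\to A\to0$ (inclusion, projection), where $M\oplus A$ has the products $(m,a)\ast(n,b)=(m\ast b+a\ast n+g(\psi;a,b),\,a\ast b)$. *)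

theory Defs
  imports "HOL-Algebra.Module" "HOL-Library.FuncSet"
begin

(* A vector space over K is a HOL-Algebra module over a field K; its inherited fields mult and one
   carry no meaning. *)

definition linear_map :: "('k, 'x) ring_scheme \<Rightarrow> ('k, 'v, 'y) module_scheme \<Rightarrow>
    ('k, 'w, 'z) module_scheme \<Rightarrow> ('v \<Rightarrow> 'w) \<Rightarrow> bool" where
  "linear_map K V W f \<longleftrightarrow> f \<in> carrier V \<rightarrow> carrier W \<and>
     (\<forall>u\<in>carrier V. \<forall>v\<in>carrier V. f (u \<oplus>\<^bsub>V\<^esub> v) = f u \<oplus>\<^bsub>W\<^esub> f v) \<and>
     (\<forall>c\<in>carrier K. \<forall>v\<in>carrier V. f (c \<odot>\<^bsub>V\<^esub> v) = c \<odot>\<^bsub>W\<^esub> f v)"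

definition bilinear_map :: "('k, 'x) ring_scheme \<Rightarrow> ('k, 'u, 'y) module_scheme \<Rightarrow>
    ('k, 'v, 'z) module_scheme \<Rightarrow> ('k, 'w, 't) module_scheme \<Rightarrow> ('u \<Rightarrow> 'v \<Rightarrow> 'w) \<Rightarrow> bool" where
  "bilinear_map K U V W f \<longleftrightarrow>
     (\<forall>u\<in>carrier U. linear_map K V W (\<lambda>v. f u v)) \<and>
     (\<forall>v\<in>carrier V. linear_map K U W (\<lambda>u. f u v))"


section \<open>Triassociative algebras and representations\<close>

(* Dashv, Vdash, Perp are the products written with a left tack, right tack, up tack. *)
datatype tri_op = Dashv | Vdash | Perp

record ('k, 'a) trialg = "('k, 'a) module" +
  tprod :: "tri_op \<Rightarrow> 'a \<Rightarrow> 'a \<Rightarrow> 'a"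

record ('k, 'm, 'a) trirep = "('k, 'm) module" +
  lact :: "tri_op \<Rightarrow> 'a \<Rightarrow> 'm \<Rightarrow> 'm"
  ract :: "tri_op \<Rightarrow> 'm \<Rightarrow> 'a \<Rightarrow> 'm"

(* (p, q, r, s) stands for the axiom (x p y) q z = x r (y s z); the order is that of (1)-(11). *)
definition trias_axioms :: "(tri_op \<times> tri_op \<times> tri_op \<times> tri_op) set" where
  "trias_axioms =
    {(Dashv, Dashv, Dashv, Dashv),
     (Dashv, Dashv, Dashv, Vdash),
     (Vdash, Dashv, Vdash, Dashv),
     (Dashv, Vdash, Vdash, Vdash),
     (Vdash, Vdash, Vdash, Vdash),
     (Dashv, Dashv, Dashv, Perp),
     (Perp,  Dashv, Perp,  Dashv),
     (Dashv, Perp,  Perp,  Vdash),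
     (Vdash, Perp,  Vdash, Perp),
     (Perp,  Vdash, Vdash, Vdash),
     (Perp,  Perp,  Perp,  Perp)}"

definition trias_algebra :: "('k, 'x) ring_scheme \<Rightarrow> ('k, 'a, 'y) trialg_scheme \<Rightarrow> bool" where
  "trias_algebra K A \<longleftrightarrow> field K \<and> module K A \<and>
     (\<forall>p. bilinear_map K A A A (tprod A p)) \<and>
     (\<forall>(p, q, r, s)\<in>trias_axioms. \<forall>x\<in>carrier A. \<forall>y\<in>carrier A. \<forall>z\<in>carrier A.
        tprod A q (tprod A p x y) z = tprod A r x (tprod A s y z))"

definition trias_rep :: "('k, 'x) ring_scheme \<Rightarrow> ('k, 'a, 'y) trialg_scheme \<Rightarrow>
    ('k, 'm, 'a, 'z) trirep_scheme \<Rightarrow> bool" where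
  "trias_rep K A M \<longleftrightarrow> field K \<and> module K M \<and>
     (\<forall>p. bilinear_map K A M M (lact M p)) \<and>
     (\<forall>p. bilinear_map K M A M (ract M p)) \<and>
     (\<forall>(p, q, r, s)\<in>trias_axioms.
        (\<forall>x\<in>carrier M. \<forall>y\<in>carrier A. \<forall>z\<in>carrier A.
           ract M q (ract M p x y) z = ract M r x (tprod A s y z)) \<and>
        (\<forall>x\<in>carrier A. \<forall>y\<in>carrier M. \<forall>z\<in>carrier A.
           ract M q (lact M p x y) z = lact M r x (ract M s y z)) \<and>
        (\<forall>x\<in>carrier A. \<forall>y\<in>carrier A. \<forall>z\<in>carrier M.
           lact M q (tprod A p x y) z = lact M r x (lact M s y z)))"

definition trias_hom :: "('k, 'x) ring_scheme \<Rightarrow> ('k, 'a, 'y) trialg_scheme \<Rightarrow>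
    ('k, 'b, 'z) trialg_scheme \<Rightarrow> ('a \<Rightarrow> 'b) \<Rightarrow> bool" where
  "trias_hom K A B f \<longleftrightarrow> linear_map K A B f \<and>
     (\<forall>p. \<forall>x\<in>carrier A. \<forall>y\<in>carrier A. f (tprod A p x y) = tprod B p (f x) (f y))"

definition abelian_trialg :: "('k, 'm, 'z) module_scheme \<Rightarrow> ('k, 'm) trialg" where
  "abelian_trialg M = \<lparr>carrier = carrier M, mult = mult M, one = one M, zero = zero M,
     add = add M, smult = smult M, tprod = (\<lambda>_ _ _. \<zero>\<^bsub>M\<^esub>)\<rparr>"


section \<open>Planar trees\<close>

datatype ptree = Leaf | Node "ptree list"

fun leaves :: "ptree \<Rightarrow> nat" where
  "leaves Leaf = 1"
| "leaves (Node ts) = sum_list (map leaves ts)"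

fun wf_tree :: "ptree \<Rightarrow> bool" where
  "wf_tree Leaf \<longleftrightarrow> True"
| "wf_tree (Node ts) \<longleftrightarrow> 2 \<le> length ts \<and> (\<forall>t\<in>set ts. wf_tree t)"

definition degree :: "ptree \<Rightarrow> nat" where
  "degree t = leaves t - 1"

definition trees :: "nat \<Rightarrow> ptree set" where
  "trees n = {t. wf_tree t \<and> leaves t = n + 1}"

fun mk_node :: "ptree list \<Rightarrow> ptree" where
  "mk_node [t] = t"
| "mk_node ts = Node ts"

(* The clauses for Leaf, Nil and out-of-range indices in the next two functions are junk:
   they are not reached from a leaf index of a tree of positive degree. *)
fun delete_leaf :: "nat \<Rightarrow> ptree \<Rightarrow> ptree"
  and delete_leaf_list :: "nat \<Rightarrow> ptree list \<Rightarrow> ptree list" where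
  "delete_leaf i Leaf = Leaf"
| "delete_leaf i (Node ts) = mk_node (delete_leaf_list i ts)"
| "delete_leaf_list i [] = []"
| "delete_leaf_list i (t # ts) =
     (if i < leaves t then (if t = Leaf then ts else delete_leaf i t # ts)
      else t # delete_leaf_list (i - leaves t) ts)"

(* Dashv, Vdash, Perp for a left oriented, right oriented, middle leaf. In the list version the
   flag says whether the list starts with the leftmost branch of the vertex. *)
fun leaf_orientation :: "nat \<Rightarrow> ptree \<Rightarrow> tri_op"
  and leaf_orientation_list :: "bool \<Rightarrow> nat \<Rightarrow> ptree list \<Rightarrow> tri_op" where
  "leaf_orientation i Leaf = undefined"
| "leaf_orientation i (Node ts) = leaf_orientation_list True i ts"
| "leaf_orientation_list leftmost i [] = undefined"
| "leaf_orientation_list leftmost i (t # ts) =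
     (if i < leaves t then
        (if t = Leaf then (if leftmost then Dashv else if ts = [] then Vdash else Perp)
         else leaf_orientation i t)
      else leaf_orientation_list False (i - leaves t) ts)"

fun branches :: "ptree \<Rightarrow> ptree list" where
  "branches Leaf = []"
| "branches (Node ts) = ts"

definition face_op :: "nat \<Rightarrow> ptree \<Rightarrow> tri_op" where
  "face_op i \<psi> =
     (if i = 0 then
        (if degree (hd (branches \<psi>)) > 0 then Vdash
         else if length (branches \<psi>) = 2 then Dashv else Perp)
      else if i = degree \<psi> then
        (if degree (last (branches \<psi>)) > 0 then Dashv
         else if length (branches \<psi>) = 2 then Vdash else Perp)
      else leaf_orientation i \<psi>)"

fun op_tree :: "tri_op \<Rightarrow> ptree" where
  "op_tree Dashv = Node [Leaf, Node [Leaf, Leaf]]"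
| "op_tree Vdash = Node [Node [Leaf, Leaf], Leaf]"
| "op_tree Perp = Node [Leaf, Leaf, Leaf]"


section \<open>Cohomology\<close>

definition tuples :: "('a, 'x) partial_object_scheme \<Rightarrow> nat \<Rightarrow> 'a list set" where
  "tuples A n = {as. length as = n \<and> set as \<subseteq> carrier A}"

(* A linear map from the tensor product of K[T n] and n copies of A to M is the same as a family,
   indexed by T n, of n-linear maps. *)
definition cochains :: "('k, 'x) ring_scheme \<Rightarrow> ('k, 'a, 'y) trialg_scheme \<Rightarrow>
    ('k, 'm, 'a, 'z) trirep_scheme \<Rightarrow> nat \<Rightarrow> (ptree \<times> 'a list \<Rightarrow> 'm) set" where
  "cochains K A M n = {f \<in> trees n \<times> tuples A n \<rightarrow>\<^sub>E carrier M.
     \<forall>\<psi>\<in>trees n. \<forall>as\<in>tuples A n. \<forall>i<n. linear_map K A M (\<lambda>x. f (\<psi>, as[i := x]))}"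

definition coface :: "('k, 'a, 'y) trialg_scheme \<Rightarrow> ('k, 'm, 'a, 'z) trirep_scheme \<Rightarrow>
    nat \<Rightarrow> nat \<Rightarrow> (ptree \<times> 'a list \<Rightarrow> 'm) \<Rightarrow> ptree \<Rightarrow> 'a list \<Rightarrow> 'm" where
  "coface A M n i f \<psi> as =
     (if i = 0 then lact M (face_op 0 \<psi>) (hd as) (f (delete_leaf 0 \<psi>, tl as))
      else if i = n + 1 then
        ract M (face_op (n + 1) \<psi>) (f (delete_leaf (n + 1) \<psi>, butlast as)) (last as)
      else f (delete_leaf i \<psi>,
        take (i - 1) as @ [tprod A (face_op i \<psi>) (as ! (i - 1)) (as ! i)] @ drop (i + 1) as))"

definition coboundary :: "('k, 'x) ring_scheme \<Rightarrow> ('k, 'a, 'y) trialg_scheme \<Rightarrow>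
    ('k, 'm, 'a, 'z) trirep_scheme \<Rightarrow> nat \<Rightarrow> (ptree \<times> 'a list \<Rightarrow> 'm) \<Rightarrow> ptree \<times> 'a list \<Rightarrow> 'm" where
  "coboundary K A M n f = (\<lambda>(\<psi>, as) \<in> trees (n + 1) \<times> tuples A (n + 1).
     \<Oplus>\<^bsub>M\<^esub>i\<in>{0..n + 1}. ((\<ominus>\<^bsub>K\<^esub> \<one>\<^bsub>K\<^esub>) [^]\<^bsub>K\<^esub> i) \<odot>\<^bsub>M\<^esub> coface A M n i f \<psi> as)"

definition zero_cochain :: "('k, 'a, 'y) trialg_scheme \<Rightarrow> ('k, 'm, 'a, 'z) trirep_scheme \<Rightarrow>
    nat \<Rightarrow> ptree \<times> 'a list \<Rightarrow> 'm" where
  "zero_cochain A M n = (\<lambda>_ \<in> trees n \<times> tuples A n. \<zero>\<^bsub>M\<^esub>)"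

definition cocycles :: "('k, 'x) ring_scheme \<Rightarrow> ('k, 'a, 'y) trialg_scheme \<Rightarrow>
    ('k, 'm, 'a, 'z) trirep_scheme \<Rightarrow> nat \<Rightarrow> (ptree \<times> 'a list \<Rightarrow> 'm) set" where
  "cocycles K A M n = {f \<in> cochains K A M n. coboundary K A M n f = zero_cochain A M (n + 1)}"

definition coboundaries :: "('k, 'x) ring_scheme \<Rightarrow> ('k, 'a, 'y) trialg_scheme \<Rightarrow>
    ('k, 'm, 'a, 'z) trirep_scheme \<Rightarrow> nat \<Rightarrow> (ptree \<times> 'a list \<Rightarrow> 'm) set" where
  "coboundaries K A M n = (if n = 0 then {zero_cochain A M 0}
     else coboundary K A M (n - 1) ` cochains K A M (n - 1))"

definition cohomologous :: "('k, 'x) ring_scheme \<Rightarrow> ('k, 'a, 'y) trialg_scheme \<Rightarrow>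
    ('k, 'm, 'a, 'z) trirep_scheme \<Rightarrow> nat \<Rightarrow>
    ((ptree \<times> 'a list \<Rightarrow> 'm) \<times> (ptree \<times> 'a list \<Rightarrow> 'm)) set" where
  "cohomologous K A M n = {(f, g). f \<in> cocycles K A M n \<and> g \<in> cocycles K A M n \<and>
     (\<lambda>x \<in> trees n \<times> tuples A n. f x \<ominus>\<^bsub>M\<^esub> g x) \<in> coboundaries K A M n}"

definition cohomology :: "('k, 'x) ring_scheme \<Rightarrow> ('k, 'a, 'y) trialg_scheme \<Rightarrow>
    ('k, 'm, 'a, 'z) trirep_scheme \<Rightarrow> nat \<Rightarrow> (ptree \<times> 'a list \<Rightarrow> 'm) set set" where
  "cohomology K A M n = cocycles K A M n // cohomologous K A M n"

definition coh_class :: "('k, 'x) ring_scheme \<Rightarrow> ('k, 'a, 'y) trialg_scheme \<Rightarrow>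
    ('k, 'm, 'a, 'z) trirep_scheme \<Rightarrow> nat \<Rightarrow> (ptree \<times> 'a list \<Rightarrow> 'm) \<Rightarrow>
    (ptree \<times> 'a list \<Rightarrow> 'm) set" where
  "coh_class K A M n f = cohomologous K A M n `` {f}"


section \<open>Abelian extensions\<close>

record ('k, 'm, 'a, 'e) extn =
  mid :: "('k, 'e) trialg"
  inc :: "'m \<Rightarrow> 'e"
  prj :: "'e \<Rightarrow> 'a"

definition abelian_extensions :: "('k, 'x) ring_scheme \<Rightarrow> ('k, 'a, 'y) trialg_scheme \<Rightarrow>
    ('k, 'm, 'a, 'z) trirep_scheme \<Rightarrow> ('k, 'm, 'a, 'e) extn set" where
  "abelian_extensions K A M = {\<xi>.
     trias_algebra K (mid \<xi>) \<and>
     trias_hom K (abelian_trialg M) (mid \<xi>) (inc \<xi>) \<and>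
     trias_hom K (mid \<xi>) A (prj \<xi>) \<and>
     inj_on (inc \<xi>) (carrier M) \<and>
     prj \<xi> ` carrier (mid \<xi>) = carrier A \<and>
     inc \<xi> ` carrier M = {e \<in> carrier (mid \<xi>). prj \<xi> e = \<zero>\<^bsub>A\<^esub>} \<and>
     (\<forall>p. \<forall>e\<in>carrier (mid \<xi>). \<forall>m\<in>carrier M.
        inc \<xi> (lact M p (prj \<xi> e) m) = tprod (mid \<xi>) p e (inc \<xi> m) \<and>
        inc \<xi> (ract M p m (prj \<xi> e)) = tprod (mid \<xi>) p (inc \<xi> m) e)}"

(* The underlying types of the two middle terms may differ. *)
definition ext_equivalent :: "('k, 'x) ring_scheme \<Rightarrow> ('k, 'm, 'z) module_scheme \<Rightarrow>
    ('k, 'm, 'a, 'e) extn \<Rightarrow> ('k, 'm, 'a, 'f) extn \<Rightarrow> bool" where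
  "ext_equivalent K M \<xi> \<xi>' \<longleftrightarrow> (\<exists>\<phi>. trias_hom K (mid \<xi>) (mid \<xi>') \<phi> \<and>
     (\<forall>m\<in>carrier M. \<phi> (inc \<xi> m) = inc \<xi>' m) \<and>
     (\<forall>e\<in>carrier (mid \<xi>). prj \<xi>' (\<phi> e) = prj \<xi> e))"

definition ext_rel :: "('k, 'x) ring_scheme \<Rightarrow> ('k, 'a, 'y) trialg_scheme \<Rightarrow>
    ('k, 'm, 'a, 'z) trirep_scheme \<Rightarrow> (('k, 'm, 'a, 'e) extn \<times> ('k, 'm, 'a, 'e) extn) set" where
  "ext_rel K A M = {(\<xi>, \<xi>'). \<xi> \<in> abelian_extensions K A M \<and> \<xi>' \<in> abelian_extensions K A M \<and>
     ext_equivalent K M \<xi> \<xi>'}"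

(* The type 'e is the universe from which the carriers of the middle terms are taken. *)
definition Ext :: "('k, 'x) ring_scheme \<Rightarrow> ('k, 'a, 'y) trialg_scheme \<Rightarrow>
    ('k, 'm, 'a, 'z) trirep_scheme \<Rightarrow> ('k, 'm, 'a, 'e) extn set set" where
  "Ext K A M = abelian_extensions K A M // ext_rel K A M"

(* The class, inside the universe 'e, of an extension whose middle term may live on another
   type 'f. *)
definition ext_class :: "('k, 'x) ring_scheme \<Rightarrow> ('k, 'a, 'y) trialg_scheme \<Rightarrow>
    ('k, 'm, 'a, 'z) trirep_scheme \<Rightarrow> ('k, 'm, 'a, 'f) extn \<Rightarrow> ('k, 'm, 'a, 'e) extn set" where
  "ext_class K A M \<xi> = {\<xi>' \<in> abelian_extensions K A M. ext_equivalent K M \<xi> \<xi>'}"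

definition linear_splitting :: "('k, 'x) ring_scheme \<Rightarrow> ('k, 'a, 'y) trialg_scheme \<Rightarrow>
    ('k, 'm, 'a, 'e) extn \<Rightarrow> ('a \<Rightarrow> 'e) \<Rightarrow> bool" where
  "linear_splitting K A \<xi> \<sigma> \<longleftrightarrow> linear_map K A (mid \<xi>) \<sigma> \<and>
     (\<forall>a\<in>carrier A. prj \<xi> (\<sigma> a) = a)"

(* Under the identification of (m, a) with i(m) + sigma(a), the products of E are
   (m, a) * (n, b) = (m * b + a * n + f(psi; a, b), a * b). *)
definition describes_products :: "('k, 'x) ring_scheme \<Rightarrow> ('k, 'a, 'y) trialg_scheme \<Rightarrow>
    ('k, 'm, 'a, 'z) trirep_scheme \<Rightarrow> ('k, 'm, 'a, 'e) extn \<Rightarrow> ('a \<Rightarrow> 'e) \<Rightarrow>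
    (ptree \<times> 'a list \<Rightarrow> 'm) \<Rightarrow> bool" where
  "describes_products K A M \<xi> \<sigma> f \<longleftrightarrow> f \<in> cochains K A M 2 \<and>
     (\<forall>p. \<forall>m\<in>carrier M. \<forall>n\<in>carrier M. \<forall>a\<in>carrier A. \<forall>b\<in>carrier A.
        tprod (mid \<xi>) p (inc \<xi> m \<oplus>\<^bsub>mid \<xi>\<^esub> \<sigma> a) (inc \<xi> n \<oplus>\<^bsub>mid \<xi>\<^esub> \<sigma> b) =
        inc \<xi> (ract M p m b \<oplus>\<^bsub>M\<^esub> lact M p a n \<oplus>\<^bsub>M\<^esub> f (op_tree p, [a, b]))
          \<oplus>\<^bsub>mid \<xi>\<^esub> \<sigma> (tprod A p a b))"

definition ext_cocycle :: "('k, 'x) ring_scheme \<Rightarrow> ('k, 'a, 'y) trialg_scheme \<Rightarrow>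
    ('k, 'm, 'a, 'z) trirep_scheme \<Rightarrow> ('k, 'm, 'a, 'e) extn \<Rightarrow> ('a \<Rightarrow> 'e) \<Rightarrow>
    ptree \<times> 'a list \<Rightarrow> 'm" where
  "ext_cocycle K A M \<xi> \<sigma> = (THE f. describes_products K A M \<xi> \<sigma> f)"

definition cocycle_ext :: "('k, 'a, 'y) trialg_scheme \<Rightarrow> ('k, 'm, 'a, 'z) trirep_scheme \<Rightarrow>
    (ptree \<times> 'a list \<Rightarrow> 'm) \<Rightarrow> ('k, 'm, 'a, 'm \<times> 'a) extn" where
  "cocycle_ext A M g =
     \<lparr>mid = \<lparr>carrier = carrier M \<times> carrier A, mult = undefined, one = undefined,
        zero = (\<zero>\<^bsub>M\<^esub>, \<zero>\<^bsub>A\<^esub>),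
        add = (\<lambda>(m, a) (n, b). (m \<oplus>\<^bsub>M\<^esub> n, a \<oplus>\<^bsub>A\<^esub> b)),
        smult = (\<lambda>c (m, a). (c \<odot>\<^bsub>M\<^esub> m, c \<odot>\<^bsub>A\<^esub> a)),
        tprod = (\<lambda>p (m, a) (n, b).
          (ract M p m b \<oplus>\<^bsub>M\<^esub> lact M p a n \<oplus>\<^bsub>M\<^esub> g (op_tree p, [a, b]), tprod A p a b))\<rparr>,
      inc = (\<lambda>m. (m, \<zero>\<^bsub>A\<^esub>)),
      prj = snd\<rparr>"

end

(*
  A splitting s of an extension turns the products of E into those of the direct sum of M and A,
  twisted by a family f of three bilinear maps, that is, by a 2-cochain. The eleven trees of
  degree 3 correspond to the eleven axioms, and the cocycle equation at a tree says that the
  twisted products satisfy the corresponding axiom on elements s x, s y, s z. The remaining content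
  is one equivalence: two split extensions with cochains f and f' are equivalent iff f - f' is a
  coboundary, because a morphism of extensions sends s a to i'(h a) + s' a for a linear map h.
  Applied to a single extension this gives independence of the splitting, and it transports the
  equivalence relation on cocycles to extensions.
*)
theory Submission
  imports Defs
begin

section \<open>Trees of small degree\<close>

text \<open>Extensions form a set only inside a universe. \<open>Ext\<close> collects those whose
  middle term lives on one fixed type, whereas the twisted product of M and A lives on pairs; an
  injection of \<open>carrier M \<times> carrier A\<close> into the universe is what lets every
  cocycle be realised there. For this reason equivalence is studied across two types, and the
  twisted product is built for an arbitrary coordinate map \<open>j\<close> instead of for pairs
  only. Linear splittings are not given either: a section of a surjective linear map is obtained
  from Zorn's lemma. The recurring device is the uniqueness of the decomposition of an element of E
  into a part from M and a lift from A. It proves linearity of everything chosen pointwise (the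
  cochain of an extension, the map h of a morphism), and it turns each identity in E into an
  identity between sums in M. The cocycle and coboundary conditions are therefore first rewritten
  without subtraction.\<close>

lemma leaves_pos: "wf_tree t \<Longrightarrow> 0 < leaves t"
proof (induction t)
  case (Node ts)
  then obtain t us where "ts = t # us" by (cases ts) auto
  with Node show ?case by auto
qed simp

text \<open>The branches above one vertex. The index counts leaves rather than degree, because
  leaves add up along a list. The length is unrestricted, so removing the first tree leads to a
  forest again.\<close>

definition forests :: "nat \<Rightarrow> ptree list set" where
  "forests n = {ts. (\<forall>t\<in>set ts. wf_tree t) \<and> sum_list (map leaves ts) = n}"

lemma forests_0: "forests 0 = {[]}"
  unfolding forests_def using leaves_pos by (auto simp: sum_list_eq_0_iff) (metis ex_in_conv less_numeral_extra(3) set_empty)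

text \<open>By \<open>leaves_pos\<close> the number of leaves is exactly one more than the degree: a
  first tree of degree k uses k + 1 of the leaves and leaves n - k for the rest.\<close>

lemma forests_Suc:
  "forests (Suc n) = (\<Union>k\<in>{..n}. (\<lambda>(t, ts). t # ts) ` (trees k \<times> forests (n - k)))"
proof (intro equalityI subsetI)
  fix ts assume "ts \<in> forests (Suc n)"
  then obtain t us where ts: "ts = t # us" and wf: "wf_tree t" "\<forall>u\<in>set us. wf_tree u"
    and sum: "leaves t + sum_list (map leaves us) = Suc n"
    by (cases ts) (auto simp: forests_def)
  have "t \<in> trees (leaves t - 1)" "us \<in> forests (n - (leaves t - 1))" "leaves t - 1 \<le> n"
    using wf sum leaves_pos[of t] by (auto simp: trees_def forests_def)
  then show "ts \<in> (\<Union>k\<in>{..n}. (\<lambda>(t, ts). t # ts) ` (trees k \<times> forests (n - k)))"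
    using ts by blast
qed (auto simp: forests_def trees_def)

lemma trees_0: "trees 0 = {Leaf}"
proof (intro equalityI subsetI)
  fix t assume t: "t \<in> trees 0"
  show "t \<in> {Leaf}"
  proof (cases t)
    case (Node ts)
    with t obtain u v us where "ts = u # v # us" and "wf_tree u" "wf_tree v"
      by (cases ts; cases "tl ts") (auto simp: trees_def)
    with t Node leaves_pos[of u] leaves_pos[of v] show ?thesis by (auto simp: trees_def)
  qed simp
qed (simp add: trees_def)

text \<open>The bound k \<le> n reserves a leaf for \<open>ts\<close>, so \<open>ts\<close> is not
  empty and the vertex has at least two branches. The right-hand side, with its forests expanded,
  involves only trees of smaller degree, so the two recursions enumerate the trees of a given
  degree.\<close>

lemma trees_Suc:
  "trees (Suc n) = (\<Union>k\<in>{..n}. (\<lambda>(t, ts). Node (t # ts)) ` (trees k \<times> forests (Suc n - k)))"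
proof (intro equalityI subsetI)
  fix \<psi> assume \<psi>: "\<psi> \<in> trees (Suc n)"
  then obtain t u us where eq: "\<psi> = Node (t # u # us)"
    by (cases \<psi>; cases "branches \<psi>"; cases "tl (branches \<psi>)") (auto simp: trees_def)
  with \<psi> have "wf_tree t" "wf_tree u" by (auto simp: trees_def)
  with \<psi> eq leaves_pos[of t] leaves_pos[of u]
  have "t \<in> trees (leaves t - 1)" "u # us \<in> forests (Suc n - (leaves t - 1))" "leaves t - 1 \<le> n"
    by (auto simp: trees_def forests_def)
  then show "\<psi> \<in> (\<Union>k\<in>{..n}. (\<lambda>(t, ts). Node (t # ts)) ` (trees k \<times> forests (Suc n - k)))"
    unfolding eq by (intro UN_I[of "leaves t - 1"] image_eqI[where x = "(t, u # us)"]) auto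
next
  fix \<psi> assume "\<psi> \<in> (\<Union>k\<in>{..n}. (\<lambda>(t, ts). Node (t # ts)) ` (trees k \<times> forests (Suc n - k)))"
  then obtain k t ts where k: "k \<le> n" "t \<in> trees k" "ts \<in> forests (Suc n - k)" "\<psi> = Node (t # ts)"
    by auto
  from k have "ts \<noteq> []" by (auto simp: forests_def)
  with k show "\<psi> \<in> trees (Suc n)" by (auto simp: trees_def forests_def Suc_le_eq)
qed

lemma trees_1: "trees 1 = {Node [Leaf, Leaf]}"
  unfolding One_nat_def trees_Suc by (simp add: forests_0 forests_Suc trees_0)

text \<open>Presenting the set as a range turns a quantifier over trees of degree 2 into one over
  the three products.\<close>

lemma trees_2: "trees 2 = range op_tree"
proof -
  have "trees 2 = {Node [Leaf, Leaf, Leaf], Node [Leaf, Node [Leaf, Leaf]], Node [Node [Leaf, Leaf], Leaf]}"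
    unfolding numeral_2_eq_2
    by (auto simp: trees_Suc forests_0 forests_Suc trees_0 atMost_Suc)
  moreover have "(UNIV :: tri_op set) = {Dashv, Vdash, Perp}"
    using tri_op.exhaust by auto
  then have "range op_tree = op_tree ` {Dashv, Vdash, Perp}" by (rule arg_cong)
  ultimately show ?thesis by auto
qed

lemma inj_op_tree: "inj op_tree"
proof (rule injI)
  show "p = q" if "op_tree p = op_tree q" for p q
    using that by (cases p; cases q) auto
qed

text \<open>The trees are listed in the order of the axioms in \<open>trias_axioms\<close> that they
  encode.\<close>

lemma trees_3:
  "trees 3 =
    {Node [Leaf, Node [Leaf, Node [Leaf, Leaf]]],
     Node [Leaf, Node [Node [Leaf, Leaf], Leaf]],
     Node [Node [Leaf, Leaf], Node [Leaf, Leaf]],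
     Node [Node [Leaf, Node [Leaf, Leaf]], Leaf],
     Node [Node [Node [Leaf, Leaf], Leaf], Leaf],
     Node [Leaf, Node [Leaf, Leaf, Leaf]],
     Node [Leaf, Leaf, Node [Leaf, Leaf]],
     Node [Leaf, Node [Leaf, Leaf], Leaf],
     Node [Node [Leaf, Leaf], Leaf, Leaf],
     Node [Node [Leaf, Leaf, Leaf], Leaf],
     Node [Leaf, Leaf, Leaf, Leaf]}"
  unfolding numeral_3_eq_3
  by (auto simp: trees_Suc forests_0 forests_Suc trees_0 atMost_Suc)

text \<open>Evaluating the four cofaces at \<open>\<psi>\<close> gives the terms of the axiom
  \<open>(x p y) q z = x r (y s z)\<close>: here \<open>p\<close> and \<open>s\<close> are the operations of the inner faces 1 and 2,
  \<open>q\<close> and \<open>r\<close> those of the outer faces 3 and 0.\<close>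
lemma tree_axioms:
  "(\<lambda>\<psi>. (face_op 1 \<psi>, face_op 3 \<psi>, face_op 0 \<psi>, face_op 2 \<psi>)) ` trees 3 = trias_axioms"
  unfolding trees_3 trias_axioms_def by (simp add: face_op_def degree_def)

text \<open>Deletion at a face yields the tree of the other operation on the same side of the axiom:
  faces 1 and 3 are exchanged (p and q), and so are faces 0 and 2 (r and s). Hence the four
  operations of the axiom determine every coface of a 2-cochain.\<close>

lemma delete_leaf_trees_3:
  assumes "\<psi> \<in> trees 3"
  shows "delete_leaf 0 \<psi> = op_tree (face_op 2 \<psi>)" "delete_leaf 1 \<psi> = op_tree (face_op 3 \<psi>)"
    "delete_leaf 2 \<psi> = op_tree (face_op 0 \<psi>)" "delete_leaf 3 \<psi> = op_tree (face_op 1 \<psi>)"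
  using assms unfolding trees_3
  by (auto simp: face_op_def degree_def)

text \<open>All faces of a tree of degree 2 carry its own operation and delete to the only tree of
  degree 1, so the coboundary of a 1-cochain has the Hochschild form separately for each
  product.\<close>

lemma faces_op_tree:
  "face_op 0 (op_tree p) = p" "face_op 1 (op_tree p) = p" "face_op 2 (op_tree p) = p"
  "i \<le> 2 \<Longrightarrow> delete_leaf i (op_tree p) = Node [Leaf, Leaf]"
  by (cases p; auto simp: face_op_def degree_def numeral_2_eq_2 le_Suc_eq)+

section \<open>Linear maps\<close>

lemma linear_mapI:
  assumes "\<And>u. u \<in> carrier V \<Longrightarrow> f u \<in> carrier W"
    and "\<And>u v. u \<in> carrier V \<Longrightarrow> v \<in> carrier V \<Longrightarrow> f (u \<oplus>\<^bsub>V\<^esub> v) = f u \<oplus>\<^bsub>W\<^esub> f v"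
    and "\<And>c v. c \<in> carrier K \<Longrightarrow> v \<in> carrier V \<Longrightarrow> f (c \<odot>\<^bsub>V\<^esub> v) = c \<odot>\<^bsub>W\<^esub> f v"
  shows "linear_map K V W f"
  using assms by (auto simp: linear_map_def)

lemma linear_map_closed: "linear_map K V W f \<Longrightarrow> u \<in> carrier V \<Longrightarrow> f u \<in> carrier W"
  and linear_map_add: "linear_map K V W f \<Longrightarrow> u \<in> carrier V \<Longrightarrow> v \<in> carrier V \<Longrightarrow>
    f (u \<oplus>\<^bsub>V\<^esub> v) = f u \<oplus>\<^bsub>W\<^esub> f v"
  and linear_map_smult: "linear_map K V W f \<Longrightarrow> c \<in> carrier K \<Longrightarrow> v \<in> carrier V \<Longrightarrow>
    f (c \<odot>\<^bsub>V\<^esub> v) = c \<odot>\<^bsub>W\<^esub> f v"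
  by (auto simp: linear_map_def)

lemma linear_map_zero:
  assumes "module K V" "module K W" "linear_map K V W f"
  shows "f \<zero>\<^bsub>V\<^esub> = \<zero>\<^bsub>W\<^esub>"
proof -
  interpret V: module K V by fact
  interpret W: module K W by fact
  have "f \<zero>\<^bsub>V\<^esub> = f (\<zero>\<^bsub>K\<^esub> \<odot>\<^bsub>V\<^esub> \<zero>\<^bsub>V\<^esub>)" by simp
  also have "\<dots> = \<zero>\<^bsub>K\<^esub> \<odot>\<^bsub>W\<^esub> f \<zero>\<^bsub>V\<^esub>"
    by (rule linear_map_smult[OF assms(3)]) auto
  also have "\<dots> = \<zero>\<^bsub>W\<^esub>" by (simp add: linear_map_closed[OF assms(3)])
  finally show ?thesis .
qed

lemma linear_map_minus:
  assumes "module K V" "module K W" "linear_map K V W f" "u \<in> carrier V" "v \<in> carrier V"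
  shows "f (u \<ominus>\<^bsub>V\<^esub> v) = f u \<ominus>\<^bsub>W\<^esub> f v"
proof -
  interpret V: module K V by fact
  interpret W: module K W by fact
  have neg: "\<ominus>\<^bsub>V\<^esub> v = (\<ominus>\<^bsub>K\<^esub> \<one>\<^bsub>K\<^esub>) \<odot>\<^bsub>V\<^esub> v"
    using assms by (simp add: V.smult_l_minus)
  have "f (\<ominus>\<^bsub>V\<^esub> v) = \<ominus>\<^bsub>W\<^esub> f v"
    unfolding neg using assms linear_map_closed[OF assms(3,5)]
    by (simp add: linear_map_smult[OF assms(3)] W.smult_l_minus)
  with assms show ?thesis
    by (simp add: a_minus_def linear_map_add[OF assms(3)])
qed

lemma bilinear_mapI:
  assumes "\<And>u v. u \<in> carrier U \<Longrightarrow> v \<in> carrier V \<Longrightarrow> f u v \<in> carrier W"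
    and "\<And>u v v'. u \<in> carrier U \<Longrightarrow> v \<in> carrier V \<Longrightarrow> v' \<in> carrier V \<Longrightarrow>
      f u (v \<oplus>\<^bsub>V\<^esub> v') = f u v \<oplus>\<^bsub>W\<^esub> f u v'"
    and "\<And>u u' v. u \<in> carrier U \<Longrightarrow> u' \<in> carrier U \<Longrightarrow> v \<in> carrier V \<Longrightarrow>
      f (u \<oplus>\<^bsub>U\<^esub> u') v = f u v \<oplus>\<^bsub>W\<^esub> f u' v"
    and "\<And>c u v. c \<in> carrier K \<Longrightarrow> u \<in> carrier U \<Longrightarrow> v \<in> carrier V \<Longrightarrow>
      f u (c \<odot>\<^bsub>V\<^esub> v) = c \<odot>\<^bsub>W\<^esub> f u v"
    and "\<And>c u v. c \<in> carrier K \<Longrightarrow> u \<in> carrier U \<Longrightarrow> v \<in> carrier V \<Longrightarrow>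
      f (c \<odot>\<^bsub>U\<^esub> u) v = c \<odot>\<^bsub>W\<^esub> f u v"
  shows "bilinear_map K U V W f"
  using assms by (auto simp: bilinear_map_def linear_map_def)

lemma bilinear_map_closed:
  "bilinear_map K U V W f \<Longrightarrow> u \<in> carrier U \<Longrightarrow> v \<in> carrier V \<Longrightarrow> f u v \<in> carrier W"
  and bilinear_map_add_right: "bilinear_map K U V W f \<Longrightarrow> u \<in> carrier U \<Longrightarrow> v \<in> carrier V \<Longrightarrow>
    v' \<in> carrier V \<Longrightarrow> f u (v \<oplus>\<^bsub>V\<^esub> v') = f u v \<oplus>\<^bsub>W\<^esub> f u v'"
  and bilinear_map_add_left: "bilinear_map K U V W f \<Longrightarrow> u \<in> carrier U \<Longrightarrow> u' \<in> carrier U \<Longrightarrow>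
    v \<in> carrier V \<Longrightarrow> f (u \<oplus>\<^bsub>U\<^esub> u') v = f u v \<oplus>\<^bsub>W\<^esub> f u' v"
  and bilinear_map_smult_right: "bilinear_map K U V W f \<Longrightarrow> c \<in> carrier K \<Longrightarrow> u \<in> carrier U \<Longrightarrow>
    v \<in> carrier V \<Longrightarrow> f u (c \<odot>\<^bsub>V\<^esub> v) = c \<odot>\<^bsub>W\<^esub> f u v"
  and bilinear_map_smult_left: "bilinear_map K U V W f \<Longrightarrow> c \<in> carrier K \<Longrightarrow> u \<in> carrier U \<Longrightarrow>
    v \<in> carrier V \<Longrightarrow> f (c \<odot>\<^bsub>U\<^esub> u) v = c \<odot>\<^bsub>W\<^esub> f u v"
  by (auto simp: bilinear_map_def linear_map_def)

lemma (in abelian_group) minus_eq_iff: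
  assumes "x \<in> carrier G" "y \<in> carrier G" "z \<in> carrier G"
  shows "x \<ominus> y = z \<longleftrightarrow> x = z \<oplus> y"
  using assms by (metis a_minus_def add.inv_solve_right)

lemma (in module) linear_map_diff:
  assumes "module R V" "linear_map R V M f" "linear_map R V M g"
  shows "linear_map R V M (\<lambda>x. f x \<ominus>\<^bsub>M\<^esub> g x)"
proof (rule linear_mapI)
  interpret V: module R V by fact
  note closed = linear_map_closed[OF assms(2)] linear_map_closed[OF assms(3)]
  fix u v assume "u \<in> carrier V" "v \<in> carrier V"
  with closed show "f u \<ominus>\<^bsub>M\<^esub> g u \<in> carrier M"
    "f (u \<oplus>\<^bsub>V\<^esub> v) \<ominus>\<^bsub>M\<^esub> g (u \<oplus>\<^bsub>V\<^esub> v) = (f u \<ominus>\<^bsub>M\<^esub> g u) \<oplus>\<^bsub>M\<^esub> (f v \<ominus>\<^bsub>M\<^esub> g v)"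
    by (simp_all add: linear_map_add[OF assms(2)] linear_map_add[OF assms(3)] a_minus_def
        M.minus_add M.a_ac)
next
  fix c v assume "c \<in> carrier R" "v \<in> carrier V"
  with linear_map_closed[OF assms(2)] linear_map_closed[OF assms(3)]
  show "f (c \<odot>\<^bsub>V\<^esub> v) \<ominus>\<^bsub>M\<^esub> g (c \<odot>\<^bsub>V\<^esub> v) = c \<odot>\<^bsub>M\<^esub> (f v \<ominus>\<^bsub>M\<^esub> g v)"
    by (simp add: linear_map_smult[OF assms(2)] linear_map_smult[OF assms(3)] a_minus_def
        smult_r_distr smult_r_minus)
qed

text \<open>A maximal subspace meeting the kernel trivially is a complement of it.\<close>
lemma linear_section_exists:
  assumes K: "field K" and V: "module K V" and W: "module K W"
    and f: "linear_map K V W f" and surj: "f ` carrier V = carrier W"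
  shows "\<exists>s. linear_map K W V s \<and> (\<forall>w\<in>carrier W. f (s w) = w)"
proof -
  interpret K: field K by fact
  interpret V: module K V by fact
  interpret W: module K W by fact
  define sub where "sub N \<longleftrightarrow> N \<subseteq> carrier V \<and> \<zero>\<^bsub>V\<^esub> \<in> N \<and> (\<forall>u\<in>N. \<forall>v\<in>N. u \<oplus>\<^bsub>V\<^esub> v \<in> N) \<and>
    (\<forall>c\<in>carrier K. \<forall>v\<in>N. c \<odot>\<^bsub>V\<^esub> v \<in> N) \<and> (\<forall>v\<in>N. f v = \<zero>\<^bsub>W\<^esub> \<longrightarrow> v = \<zero>\<^bsub>V\<^esub>)" for N
  have "\<exists>N\<in>{N. sub N}. \<forall>X\<in>{N. sub N}. N \<subseteq> X \<longrightarrow> X = N"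
  proof (rule subset_Zorn_nonempty)
    have "sub {\<zero>\<^bsub>V\<^esub>}" by (auto simp: sub_def)
    then show "{N. sub N} \<noteq> {}" by blast
  next
    fix C assume C: "C \<noteq> {}" "subset.chain {N. sub N} C"
    then have s: "sub N" if "N \<in> C" for N using that by (auto simp: subset_chain_def)
    have lin: "N \<subseteq> N' \<or> N' \<subseteq> N" if "N \<in> C" "N' \<in> C" for N N'
      using that C by (auto simp: subset_chain_def)
    have "u \<oplus>\<^bsub>V\<^esub> v \<in> \<Union>C" if "u \<in> \<Union>C" "v \<in> \<Union>C" for u v
    proof -
      from that obtain N N' where N: "N \<in> C" "N' \<in> C" "u \<in> N" "v \<in> N'" by blast
      then obtain L where "L \<in> C" "u \<in> L" "v \<in> L" using lin[of N N'] by blast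
      with s[of L] show ?thesis by (auto simp: sub_def)
    qed
    moreover have "\<Union>C \<subseteq> carrier V" "\<forall>c\<in>carrier K. \<forall>v\<in>\<Union>C. c \<odot>\<^bsub>V\<^esub> v \<in> \<Union>C"
      "\<forall>v\<in>\<Union>C. f v = \<zero>\<^bsub>W\<^esub> \<longrightarrow> v = \<zero>\<^bsub>V\<^esub>"
      using s unfolding sub_def by blast+
    moreover have "\<zero>\<^bsub>V\<^esub> \<in> \<Union>C" using C(1) s unfolding sub_def by blast
    ultimately show "\<Union>C \<in> {N. sub N}" unfolding sub_def by blast
  qed
  then obtain N where N: "sub N" and max: "\<And>X. sub X \<Longrightarrow> N \<subseteq> X \<Longrightarrow> X = N" by blast
  have NV: "N \<subseteq> carrier V" and N0: "\<zero>\<^bsub>V\<^esub> \<in> N"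
    and Nadd: "\<And>u v. u \<in> N \<Longrightarrow> v \<in> N \<Longrightarrow> u \<oplus>\<^bsub>V\<^esub> v \<in> N"
    and Nsm: "\<And>c v. c \<in> carrier K \<Longrightarrow> v \<in> N \<Longrightarrow> c \<odot>\<^bsub>V\<^esub> v \<in> N"
    and Nker: "\<And>v. v \<in> N \<Longrightarrow> f v = \<zero>\<^bsub>W\<^esub> \<Longrightarrow> v = \<zero>\<^bsub>V\<^esub>"
    using N by (auto simp: sub_def)
  note NV' = subsetD[OF NV]
  have inj: "u = v" if "u \<in> N" "v \<in> N" "f u = f v" for u v
  proof -
    have "v \<in> carrier V" "u \<in> carrier V" using that NV by auto
    then have neg: "\<ominus>\<^bsub>V\<^esub> v = (\<ominus>\<^bsub>K\<^esub> \<one>\<^bsub>K\<^esub>) \<odot>\<^bsub>V\<^esub> v" by (simp add: V.smult_l_minus)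
    have "u \<ominus>\<^bsub>V\<^esub> v \<in> N"
      unfolding a_minus_def neg using that by (intro Nadd Nsm) auto
    moreover have "f (u \<ominus>\<^bsub>V\<^esub> v) = \<zero>\<^bsub>W\<^esub>"
      using that \<open>u \<in> carrier V\<close> \<open>v \<in> carrier V\<close> linear_map_closed[OF f]
      by (simp add: linear_map_minus[OF V W f] W.M.minus_eq_iff)
    ultimately have "u \<ominus>\<^bsub>V\<^esub> v = \<zero>\<^bsub>V\<^esub>" by (rule Nker)
    then show ?thesis using \<open>u \<in> carrier V\<close> \<open>v \<in> carrier V\<close>
      by (simp add: V.M.minus_eq_iff)
  qed
  have surjN: "\<exists>v\<in>N. f v = w" if w: "w \<in> carrier W" for w
  proof (rule ccontr)
    assume no: "\<not> (\<exists>v\<in>N. f v = w)"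
    from w surj obtain e where e: "e \<in> carrier V" "f e = w" by (metis imageE)
    \<comment> \<open>N is enlarged by the line through a preimage \<open>e\<close> of the missed
      vector \<open>w\<close>; if the result still meets the kernel trivially, maximality of N is
      violated.\<close>
    define X where "X = {v \<oplus>\<^bsub>V\<^esub> c \<odot>\<^bsub>V\<^esub> e | v c. v \<in> N \<and> c \<in> carrier K}"
    have "sub X"
      unfolding sub_def
    proof (intro conjI ballI impI)
      show "X \<subseteq> carrier V" using NV e by (auto simp: X_def)
      have "\<zero>\<^bsub>V\<^esub> = \<zero>\<^bsub>V\<^esub> \<oplus>\<^bsub>V\<^esub> \<zero>\<^bsub>K\<^esub> \<odot>\<^bsub>V\<^esub> e" using e by simp
      then show "\<zero>\<^bsub>V\<^esub> \<in> X" using N0 unfolding X_def by blast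
    next
      fix x y assume "x \<in> X" "y \<in> X"
      then obtain u c v d where *: "u \<in> N" "v \<in> N" "c \<in> carrier K" "d \<in> carrier K"
        "x = u \<oplus>\<^bsub>V\<^esub> c \<odot>\<^bsub>V\<^esub> e" "y = v \<oplus>\<^bsub>V\<^esub> d \<odot>\<^bsub>V\<^esub> e" unfolding X_def by blast
      then have "x \<oplus>\<^bsub>V\<^esub> y = (u \<oplus>\<^bsub>V\<^esub> v) \<oplus>\<^bsub>V\<^esub> (c \<oplus>\<^bsub>K\<^esub> d) \<odot>\<^bsub>V\<^esub> e"
        using e NV' by (simp add: V.smult_l_distr V.M.a_ac)
      then show "x \<oplus>\<^bsub>V\<^esub> y \<in> X" unfolding X_def using * Nadd by blast
    next
      fix c x assume c: "c \<in> carrier K" and "x \<in> X"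
      then obtain u d where *: "u \<in> N" "d \<in> carrier K" "x = u \<oplus>\<^bsub>V\<^esub> d \<odot>\<^bsub>V\<^esub> e"
        unfolding X_def by blast
      then have "c \<odot>\<^bsub>V\<^esub> x = c \<odot>\<^bsub>V\<^esub> u \<oplus>\<^bsub>V\<^esub> (c \<otimes>\<^bsub>K\<^esub> d) \<odot>\<^bsub>V\<^esub> e"
        using c e NV' by (simp add: V.smult_r_distr V.smult_assoc1)
      then show "c \<odot>\<^bsub>V\<^esub> x \<in> X" unfolding X_def using * c Nsm by blast
    next
      fix x assume "x \<in> X" and x0: "f x = \<zero>\<^bsub>W\<^esub>"
      then obtain u d where *: "u \<in> N" "d \<in> carrier K" "x = u \<oplus>\<^bsub>V\<^esub> d \<odot>\<^bsub>V\<^esub> e"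
        unfolding X_def by blast
      have uV: "u \<in> carrier V" using * NV by auto
      have eq: "f u \<oplus>\<^bsub>W\<^esub> d \<odot>\<^bsub>W\<^esub> w = \<zero>\<^bsub>W\<^esub>"
        using x0 * e uV by (simp add: linear_map_add[OF f] linear_map_smult[OF f])
      \<comment> \<open>A nonzero \<open>d\<close> could be inverted, and the multiple of
        \<open>u\<close> by its negative inverse would be an element of N mapped to
        \<open>w\<close>.\<close>
      have "d = \<zero>\<^bsub>K\<^esub>"
      proof (rule ccontr)
        assume "d \<noteq> \<zero>\<^bsub>K\<^esub>"
        then have dU: "d \<in> Units K" using * K.field_Units by auto
        define c where "c = \<ominus>\<^bsub>K\<^esub> (inv\<^bsub>K\<^esub> d)"
        have c: "c \<in> carrier K" using dU by (simp add: c_def)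
        have "f u = \<ominus>\<^bsub>W\<^esub> (d \<odot>\<^bsub>W\<^esub> w)"
          using eq * w linear_map_closed[OF f uV] by (simp add: W.M.minus_equality)
        then have "f (c \<odot>\<^bsub>V\<^esub> u) = c \<odot>\<^bsub>W\<^esub> \<ominus>\<^bsub>W\<^esub> (d \<odot>\<^bsub>W\<^esub> w)"
          using c uV by (simp add: linear_map_smult[OF f])
        also have "\<dots> = inv\<^bsub>K\<^esub> d \<odot>\<^bsub>W\<^esub> (d \<odot>\<^bsub>W\<^esub> w)"
          using dU w * by (simp add: c_def W.smult_l_minus W.smult_r_minus)
        also have "\<dots> = w"
          using dU w * by (simp add: W.smult_assoc1[symmetric])
        finally show False using no Nsm[OF c] * by blast
      qed
      then have "x = u" using * e uV by simp
      then show "x = \<zero>\<^bsub>V\<^esub>" using Nker * x0 by simp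
    qed
    moreover have "N \<subseteq> X"
    proof
      fix v assume v: "v \<in> N"
      then have "v = v \<oplus>\<^bsub>V\<^esub> \<zero>\<^bsub>K\<^esub> \<odot>\<^bsub>V\<^esub> e" using NV' e by simp
      then show "v \<in> X" unfolding X_def using v by blast
    qed
    ultimately have "X = N" by (rule max)
    have "e = \<zero>\<^bsub>V\<^esub> \<oplus>\<^bsub>V\<^esub> \<one>\<^bsub>K\<^esub> \<odot>\<^bsub>V\<^esub> e" using e by simp
    then have "e \<in> X" unfolding X_def using N0 by blast
    with \<open>X = N\<close> e no show False by blast
  qed
  \<comment> \<open>\<open>s\<close> inverts the bijection from N to W induced by \<open>f\<close>.
    Its linearity is checked after applying \<open>f\<close>, by injectivity on N.\<close>
  from surjN obtain s where s: "\<And>w. w \<in> carrier W \<Longrightarrow> s w \<in> N \<and> f (s w) = w" by metis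
  have "linear_map K W V s"
  proof (rule linear_mapI)
    show "s u \<in> carrier V" if "u \<in> carrier W" for u using s that NV by auto
    show "s (u \<oplus>\<^bsub>W\<^esub> v) = s u \<oplus>\<^bsub>V\<^esub> s v" if "u \<in> carrier W" "v \<in> carrier W" for u v
      using that s[of u] s[of v] s[of "u \<oplus>\<^bsub>W\<^esub> v"] Nadd NV'
      by (intro inj) (auto simp: linear_map_add[OF f])
    show "s (c \<odot>\<^bsub>W\<^esub> v) = c \<odot>\<^bsub>V\<^esub> s v" if "c \<in> carrier K" "v \<in> carrier W" for c v
      using that s[of v] s[of "c \<odot>\<^bsub>W\<^esub> v"] Nsm NV'
      by (intro inj) (auto simp: linear_map_smult[OF f])
  qed
  with s show ?thesis by blast
qed

section \<open>Cochains of low degree\<close>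

declare One_nat_def [simp del]

locale trias_rep_data =
  fixes K :: "('k, 'x) ring_scheme"
    and A :: "('k, 'a, 'y) trialg_scheme"
    and M :: "('k, 'm, 'a, 'z) trirep_scheme"
  assumes K: "field K"
    and A: "trias_algebra K A"
    and M: "trias_rep K A M"
begin

sublocale K: field K by (rule K)
sublocale A: module K A using A by (simp add: trias_algebra_def)
sublocale M: module K M using M by (simp add: trias_rep_def)

lemma tprod_bilinear: "bilinear_map K A A A (tprod A p)"
  using A by (simp add: trias_algebra_def)

lemma lact_bilinear: "bilinear_map K A M M (lact M p)"
  and ract_bilinear: "bilinear_map K M A M (ract M p)"
  using M by (simp_all add: trias_rep_def)

lemmas closed [simp] = bilinear_map_closed[OF tprod_bilinear] bilinear_map_closed[OF lact_bilinear]
  bilinear_map_closed[OF ract_bilinear]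

lemmas act_simps =
  bilinear_map_add_right[OF tprod_bilinear] bilinear_map_add_right[OF lact_bilinear]
  bilinear_map_add_right[OF ract_bilinear]
  bilinear_map_add_left[OF tprod_bilinear] bilinear_map_add_left[OF lact_bilinear]
  bilinear_map_add_left[OF ract_bilinear]
  bilinear_map_smult_right[OF tprod_bilinear] bilinear_map_smult_right[OF lact_bilinear]
  bilinear_map_smult_right[OF ract_bilinear]
  bilinear_map_smult_left[OF tprod_bilinear] bilinear_map_smult_left[OF lact_bilinear]
  bilinear_map_smult_left[OF ract_bilinear]

lemma act_zero [simp]:
  "a \<in> carrier A \<Longrightarrow> lact M p a \<zero>\<^bsub>M\<^esub> = \<zero>\<^bsub>M\<^esub>" "a \<in> carrier A \<Longrightarrow> ract M p \<zero>\<^bsub>M\<^esub> a = \<zero>\<^bsub>M\<^esub>"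
  "m \<in> carrier M \<Longrightarrow> lact M p \<zero>\<^bsub>A\<^esub> m = \<zero>\<^bsub>M\<^esub>" "m \<in> carrier M \<Longrightarrow> ract M p m \<zero>\<^bsub>A\<^esub> = \<zero>\<^bsub>M\<^esub>"
  "a \<in> carrier A \<Longrightarrow> tprod A p a \<zero>\<^bsub>A\<^esub> = \<zero>\<^bsub>A\<^esub>" "a \<in> carrier A \<Longrightarrow> tprod A p \<zero>\<^bsub>A\<^esub> a = \<zero>\<^bsub>A\<^esub>"
  using lact_bilinear[of p] ract_bilinear[of p] tprod_bilinear[of p]
    linear_map_zero[OF M.module_axioms M.module_axioms]
    linear_map_zero[OF A.module_axioms M.module_axioms]
    linear_map_zero[OF A.module_axioms A.module_axioms]
  unfolding bilinear_map_def by blast+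

section \<open>Cochains of degree one and two as linear and bilinear maps\<close>

lemma tuples_1: "tuples A 1 = {[a] | a. a \<in> carrier A}"
  and tuples_2: "tuples A 2 = {[a, b] | a b. a \<in> carrier A \<and> b \<in> carrier A}"
  and tuples_3: "tuples A 3 =
    {[a, b, c] | a b c. a \<in> carrier A \<and> b \<in> carrier A \<and> c \<in> carrier A}"
  by (auto simp: tuples_def length_Suc_conv numeral_2_eq_2 numeral_3_eq_3 One_nat_def)

lemma cochains_1:
  "f \<in> cochains K A M 1 \<longleftrightarrow> f \<in> extensional (trees 1 \<times> tuples A 1) \<and>
    linear_map K A M (\<lambda>a. f (Node [Leaf, Leaf], [a]))"
    (is "_ \<longleftrightarrow> ?r")
proof
  assume "f \<in> cochains K A M 1"
  \<comment> \<open>Linearity in \<open>cochains\<close> is stated by overwriting an entry of a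
    tuple; the zero vector only supplies a tuple to overwrite.\<close>
  moreover have "[\<zero>\<^bsub>A\<^esub>] \<in> tuples A 1" by (simp add: tuples_1)
  ultimately have "linear_map K A M (\<lambda>x. f (Node [Leaf, Leaf], [\<zero>\<^bsub>A\<^esub>][0 := x]))"
    by (fastforce simp: cochains_def trees_1 simp del: list_update.simps)
  with \<open>f \<in> cochains K A M 1\<close> show ?r by (simp add: cochains_def PiE_def)
next
  assume ?r
  then show "f \<in> cochains K A M 1"
    by (auto simp: cochains_def tuples_1 trees_1 PiE_def dest: linear_map_closed)
qed

text \<open>Overwriting entry 0 or 1 of a pair gives linearity in each argument, and
  \<open>trees_2\<close> replaces the tree by its product.\<close>

lemma cochains_2:
  "f \<in> cochains K A M 2 \<longleftrightarrow> f \<in> extensional (trees 2 \<times> tuples A 2) \<and>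
    (\<forall>p. bilinear_map K A A M (\<lambda>a b. f (op_tree p, [a, b])))" (is "_ \<longleftrightarrow> ?r")
proof
  assume f: "f \<in> cochains K A M 2"
  have lin: "linear_map K A M (\<lambda>x. f (op_tree p, [a, b][i := x]))"
    if "a \<in> carrier A" "b \<in> carrier A" "i < 2" for p a b i
  proof -
    have "op_tree p \<in> trees 2" "[a, b] \<in> tuples A 2" using that by (auto simp: tuples_2 trees_2)
    with f \<open>i < 2\<close> show ?thesis unfolding cochains_def by blast
  qed
  show ?r
    using f lin[where i = 0] lin[where i = 1]
    by (auto simp: cochains_def PiE_def bilinear_map_def One_nat_def)
next
  assume f: ?r
  have "f (op_tree p, [a, b]) \<in> carrier M" if "a \<in> carrier A" "b \<in> carrier A" for p a b
    using f that bilinear_map_closed[of K A A M "\<lambda>a b. f (op_tree p, [a, b])" a b] by simp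
  with f show "f \<in> cochains K A M 2"
    by (auto simp: cochains_def PiE_def tuples_2 trees_2 bilinear_map_def less_2_cases_iff One_nat_def)
qed

text \<open>Cochains are extensional, so nothing outside the domain can differ. The uniqueness
  needed for the definite description \<open>ext_cocycle\<close> rests on this.\<close>

lemma cochain_2_eqI:
  assumes "f \<in> cochains K A M 2" "g \<in> cochains K A M 2"
    and "\<And>p a b. a \<in> carrier A \<Longrightarrow> b \<in> carrier A \<Longrightarrow> f (op_tree p, [a, b]) = g (op_tree p, [a, b])"
  shows "f = g"
proof (rule extensionalityI)
  show "f \<in> extensional (trees 2 \<times> tuples A 2)" "g \<in> extensional (trees 2 \<times> tuples A 2)"
    using assms by (simp_all add: cochains_2)
  show "f x = g x" if "x \<in> trees 2 \<times> tuples A 2" for x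
    using that assms(3) by (auto simp: trees_2 tuples_2)
qed

lemma cochain_2_exists:
  assumes "\<And>p. bilinear_map K A A M (F p)"
  shows "\<exists>f\<in>cochains K A M 2. \<forall>p. \<forall>a\<in>carrier A. \<forall>b\<in>carrier A. f (op_tree p, [a, b]) = F p a b"
proof
  \<comment> \<open>Injectivity of \<open>op_tree\<close> allows the product to be recovered from
    the tree.\<close>
  let ?f = "\<lambda>(\<psi>, as) \<in> trees 2 \<times> tuples A 2. F (the_inv op_tree \<psi>) (as ! 0) (as ! 1)"
  have *: "?f (op_tree p, [a, b]) = F p a b" if "a \<in> carrier A" "b \<in> carrier A" for p a b
    using that by (auto simp: trees_2 tuples_2 the_inv_f_f[OF inj_op_tree] One_nat_def)
  then show "\<forall>p. \<forall>a\<in>carrier A. \<forall>b\<in>carrier A. ?f (op_tree p, [a, b]) = F p a b" by blast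
  have "bilinear_map K A A M (\<lambda>a b. ?f (op_tree p, [a, b]))" for p
    using assms[of p] * by (simp add: bilinear_map_def linear_map_def Pi_def)
  then show "?f \<in> cochains K A M 2"
    unfolding cochains_2 by (metis restrict_extensional)
qed

lemma cocycles_cochains: "g \<in> cocycles K A M n \<Longrightarrow> g \<in> cochains K A M n"
  by (simp add: cocycles_def)

lemma cochain_closed [simp]:
  "g \<in> cochains K A M 2 \<Longrightarrow> a \<in> carrier A \<Longrightarrow> b \<in> carrier A \<Longrightarrow> g (op_tree p, [a, b]) \<in> carrier M"
  using bilinear_map_closed[of K A A M "\<lambda>a b. g (op_tree p, [a, b])" a b]
  by (simp add: cochains_2)

section \<open>Coboundaries and the cohomology relation in degree two\<close>

lemma minus_one_pow:
  "(\<ominus>\<^bsub>K\<^esub> \<one>\<^bsub>K\<^esub>) [^]\<^bsub>K\<^esub> (1::nat) = \<ominus>\<^bsub>K\<^esub> \<one>\<^bsub>K\<^esub>" "(\<ominus>\<^bsub>K\<^esub> \<one>\<^bsub>K\<^esub>) [^]\<^bsub>K\<^esub> (2::nat) = \<one>\<^bsub>K\<^esub>"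
  "(\<ominus>\<^bsub>K\<^esub> \<one>\<^bsub>K\<^esub>) [^]\<^bsub>K\<^esub> (3::nat) = \<ominus>\<^bsub>K\<^esub> \<one>\<^bsub>K\<^esub>"
  by (simp_all add: numeral_2_eq_2 numeral_3_eq_3 One_nat_def K.l_minus K.r_minus)

lemma coface_2:
  assumes "g \<in> cochains K A M 2" "\<psi> \<in> trees 3" "x \<in> carrier A" "y \<in> carrier A" "z \<in> carrier A"
  shows "coface A M 2 0 g \<psi> [x, y, z] = lact M (face_op 0 \<psi>) x (g (op_tree (face_op 2 \<psi>), [y, z]))"
    "coface A M 2 1 g \<psi> [x, y, z] = g (op_tree (face_op 3 \<psi>), [tprod A (face_op 1 \<psi>) x y, z])"
    "coface A M 2 2 g \<psi> [x, y, z] = g (op_tree (face_op 0 \<psi>), [x, tprod A (face_op 2 \<psi>) y z])"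
    "coface A M 2 3 g \<psi> [x, y, z] = ract M (face_op 3 \<psi>) (g (op_tree (face_op 1 \<psi>), [x, y])) z"
  using assms by (simp_all add: coface_def delete_leaf_trees_3)

text \<open>The signs set cofaces 0 and 2 against cofaces 1 and 3, and \<open>tree_axioms\<close>
  trades the tree for the axiom it encodes. Without subtraction, the two sides are the contributions
  of \<open>g\<close> to the two bracketings of x, y, z.\<close>

lemma cocycles_2:
  "g \<in> cocycles K A M 2 \<longleftrightarrow> g \<in> cochains K A M 2 \<and>
    (\<forall>(p, q, r, s)\<in>trias_axioms. \<forall>x\<in>carrier A. \<forall>y\<in>carrier A. \<forall>z\<in>carrier A.
      ract M q (g (op_tree p, [x, y])) z \<oplus>\<^bsub>M\<^esub> g (op_tree q, [tprod A p x y, z]) =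
      lact M r x (g (op_tree s, [y, z])) \<oplus>\<^bsub>M\<^esub> g (op_tree r, [x, tprod A s y z]))"
proof (cases "g \<in> cochains K A M 2")
  case g: True
  have sum: "coboundary K A M 2 g (\<psi>, [x, y, z]) = \<zero>\<^bsub>M\<^esub> \<longleftrightarrow>
      ract M (face_op 3 \<psi>) (g (op_tree (face_op 1 \<psi>), [x, y])) z \<oplus>\<^bsub>M\<^esub>
        g (op_tree (face_op 3 \<psi>), [tprod A (face_op 1 \<psi>) x y, z]) =
      lact M (face_op 0 \<psi>) x (g (op_tree (face_op 2 \<psi>), [y, z])) \<oplus>\<^bsub>M\<^esub>
        g (op_tree (face_op 0 \<psi>), [x, tprod A (face_op 2 \<psi>) y z])"
    (is "_ \<longleftrightarrow> ?d3 \<oplus>\<^bsub>M\<^esub> ?d1 = ?d0 \<oplus>\<^bsub>M\<^esub> ?d2")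
    if "\<psi> \<in> trees 3" "x \<in> carrier A" "y \<in> carrier A" "z \<in> carrier A" for \<psi> x y z
  proof -
    have c: "?d0 \<in> carrier M" "?d1 \<in> carrier M" "?d2 \<in> carrier M" "?d3 \<in> carrier M"
      using that g by auto
    have "coboundary K A M 2 g (\<psi>, [x, y, z]) =
        (\<Oplus>\<^bsub>M\<^esub>i\<in>{0, 1, 2, 3}. ((\<ominus>\<^bsub>K\<^esub> \<one>\<^bsub>K\<^esub>) [^]\<^bsub>K\<^esub> i) \<odot>\<^bsub>M\<^esub> coface A M 2 i g \<psi> [x, y, z])"
      using that by (auto simp: coboundary_def tuples_3 intro!: arg_cong[where f = "finsum M _"])
    also have "\<dots> = ?d0 \<oplus>\<^bsub>M\<^esub> (\<ominus>\<^bsub>M\<^esub> ?d1 \<oplus>\<^bsub>M\<^esub> (?d2 \<oplus>\<^bsub>M\<^esub> \<ominus>\<^bsub>M\<^esub> ?d3))"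
      using that g c
      by (simp add: Pi_def coface_2[OF g that] minus_one_pow M.smult_l_minus)
    also have "\<dots> = (?d0 \<oplus>\<^bsub>M\<^esub> ?d2) \<ominus>\<^bsub>M\<^esub> (?d3 \<oplus>\<^bsub>M\<^esub> ?d1)"
      using c by (simp add: a_minus_def M.minus_add M.M.a_ac)
    finally show ?thesis using c by (auto simp: M.M.minus_eq_iff)
  qed
  have "coboundary K A M 2 g = zero_cochain A M 3 \<longleftrightarrow>
      (\<forall>x\<in>trees 3 \<times> tuples A 3. coboundary K A M 2 g x = \<zero>\<^bsub>M\<^esub>)"
  proof
    assume *: "\<forall>x\<in>trees 3 \<times> tuples A 3. coboundary K A M 2 g x = \<zero>\<^bsub>M\<^esub>"
    show "coboundary K A M 2 g = zero_cochain A M 3"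
      by (rule extensionalityI[of _ "trees 3 \<times> tuples A 3"])
        (use * in \<open>auto simp: coboundary_def zero_cochain_def\<close>)
  qed (simp add: zero_cochain_def)
  also have "\<dots> \<longleftrightarrow> (\<forall>\<psi>\<in>trees 3. \<forall>x\<in>carrier A. \<forall>y\<in>carrier A. \<forall>z\<in>carrier A.
      coboundary K A M 2 g (\<psi>, [x, y, z]) = \<zero>\<^bsub>M\<^esub>)"
    by (auto simp: tuples_3)
  finally show ?thesis
    using g sum by (simp add: cocycles_def tree_axioms[symmetric])
qed (simp add: cocycles_def)

text \<open>By \<open>faces_op_tree\<close> all three cofaces use the same product, so the result is
  the failure of \<open>h\<close> to be a derivation for \<open>p\<close>.\<close>

lemma coboundary_1:
  assumes h: "h \<in> cochains K A M 1" and "a \<in> carrier A" "b \<in> carrier A"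
  shows "coboundary K A M 1 h (op_tree p, [a, b]) =
    lact M p a (h (Node [Leaf, Leaf], [b])) \<oplus>\<^bsub>M\<^esub> ract M p (h (Node [Leaf, Leaf], [a])) b
      \<ominus>\<^bsub>M\<^esub> h (Node [Leaf, Leaf], [tprod A p a b])" (is "_ = ?d0 \<oplus>\<^bsub>M\<^esub> ?d2 \<ominus>\<^bsub>M\<^esub> ?d1")
proof -
  have "linear_map K A M (\<lambda>a. h (Node [Leaf, Leaf], [a]))" using h by (simp add: cochains_1)
  from linear_map_closed[OF this]
  have c: "?d0 \<in> carrier M" "?d1 \<in> carrier M" "?d2 \<in> carrier M"
    using assms by auto
  have faces: "coface A M 1 0 h (op_tree p) [a, b] = ?d0"
    "coface A M 1 1 h (op_tree p) [a, b] = ?d1" "coface A M 1 2 h (op_tree p) [a, b] = ?d2"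
    by (simp_all add: coface_def faces_op_tree numeral_2_eq_2[symmetric])
  have "coboundary K A M 1 h (op_tree p, [a, b]) =
      (\<Oplus>\<^bsub>M\<^esub>i\<in>{0, 1, 2}. ((\<ominus>\<^bsub>K\<^esub> \<one>\<^bsub>K\<^esub>) [^]\<^bsub>K\<^esub> i) \<odot>\<^bsub>M\<^esub> coface A M 1 i h (op_tree p) [a, b])"
    using assms by (auto simp: coboundary_def tuples_2 trees_2 intro!: arg_cong[where f = "finsum M _"])
  also have "\<dots> = ?d0 \<oplus>\<^bsub>M\<^esub> (\<ominus>\<^bsub>M\<^esub> ?d1 \<oplus>\<^bsub>M\<^esub> ?d2)"
    using c by (simp add: Pi_def faces minus_one_pow M.smult_l_minus)
  finally show ?thesis using c by (simp add: a_minus_def M.M.a_ac)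
qed

text \<open>Moving the subtracted terms across turns "\<open>f\<close> minus \<open>g\<close> is the
  coboundary of \<open>h\<close>" into an identity of sums, the shape in which compatibility of a
  morphism with products appears. Here \<open>h\<close> is constrained on \<open>carrier A\<close>
  only, whence the passage between such maps and 1-cochains.\<close>

lemma cohomologous_2:
  "(f, g) \<in> cohomologous K A M 2 \<longleftrightarrow> f \<in> cocycles K A M 2 \<and> g \<in> cocycles K A M 2 \<and>
    (\<exists>h. linear_map K A M h \<and> (\<forall>p. \<forall>a\<in>carrier A. \<forall>b\<in>carrier A.
      f (op_tree p, [a, b]) \<oplus>\<^bsub>M\<^esub> h (tprod A p a b) =
      lact M p a (h b) \<oplus>\<^bsub>M\<^esub> ract M p (h a) b \<oplus>\<^bsub>M\<^esub> g (op_tree p, [a, b])))"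
  (is "_ \<longleftrightarrow> _ \<and> _ \<and> (\<exists>h. ?C h)")
proof (cases "f \<in> cocycles K A M 2 \<and> g \<in> cocycles K A M 2")
  case fg: True
  note fg' = fg[THEN conjunct1, THEN cocycles_cochains] fg[THEN conjunct2, THEN cocycles_cochains]
  let ?d = "\<lambda>x \<in> trees 2 \<times> tuples A 2. f x \<ominus>\<^bsub>M\<^esub> g x"
  let ?D = "trees 2 \<times> tuples A 2"
  have eq: "?d = coboundary K A M 1 h \<longleftrightarrow> ?C (\<lambda>a. h (Node [Leaf, Leaf], [a]))"
    if h: "h \<in> cochains K A M 1" for h
  proof -
    have lin: "linear_map K A M (\<lambda>a. h (Node [Leaf, Leaf], [a]))"
      using h by (simp add: cochains_1)
    have "?d = coboundary K A M 1 h \<longleftrightarrow> (\<forall>x\<in>?D. ?d x = coboundary K A M 1 h x)"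
    proof
      assume *: "\<forall>x\<in>?D. ?d x = coboundary K A M 1 h x"
      show "?d = coboundary K A M 1 h"
        by (rule extensionalityI[of _ ?D]) (use * in \<open>auto simp: coboundary_def numeral_2_eq_2\<close>)
    qed simp
    also have "\<dots> \<longleftrightarrow> (\<forall>p. \<forall>a\<in>carrier A. \<forall>b\<in>carrier A.
        f (op_tree p, [a, b]) \<ominus>\<^bsub>M\<^esub> g (op_tree p, [a, b]) = coboundary K A M 1 h (op_tree p, [a, b]))"
      by (auto simp: trees_2 tuples_2)
    also have "\<dots> \<longleftrightarrow> ?C (\<lambda>a. h (Node [Leaf, Leaf], [a]))"
    proof -
      have "f (op_tree p, [a, b]) \<ominus>\<^bsub>M\<^esub> g (op_tree p, [a, b]) = coboundary K A M 1 h (op_tree p, [a, b])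
        \<longleftrightarrow> f (op_tree p, [a, b]) \<oplus>\<^bsub>M\<^esub> h (Node [Leaf, Leaf], [tprod A p a b]) =
          lact M p a (h (Node [Leaf, Leaf], [b])) \<oplus>\<^bsub>M\<^esub> ract M p (h (Node [Leaf, Leaf], [a])) b
          \<oplus>\<^bsub>M\<^esub> g (op_tree p, [a, b])" (is "?x \<ominus>\<^bsub>M\<^esub> ?y = _ \<longleftrightarrow> ?x \<oplus>\<^bsub>M\<^esub> ?u = ?v \<oplus>\<^bsub>M\<^esub> ?y")
        if ab: "a \<in> carrier A" "b \<in> carrier A" for p a b
      proof -
        have c: "?x \<in> carrier M" "?y \<in> carrier M" "?u \<in> carrier M" "?v \<in> carrier M"
          using ab fg' linear_map_closed[OF lin] by auto
        have "?x \<ominus>\<^bsub>M\<^esub> ?y = ?v \<ominus>\<^bsub>M\<^esub> ?u \<longleftrightarrow> ?v \<oplus>\<^bsub>M\<^esub> ?y = ?x \<oplus>\<^bsub>M\<^esub> ?u"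
          using c by (simp add: M.M.minus_eq_iff)
            (smt (verit) M.M.a_ac M.M.minus_eq_iff M.M.minus_closed M.M.add.m_closed)
        then show ?thesis unfolding coboundary_1[OF h ab] by auto
      qed
      then show ?thesis using lin by auto
    qed
    finally show ?thesis .
  qed
  have "(\<exists>h\<in>cochains K A M 1. ?d = coboundary K A M 1 h) \<longleftrightarrow> (\<exists>h. ?C h)"
  proof
    assume "\<exists>h. ?C h"
    then obtain h where h: "?C h" by blast
    \<comment> \<open>Restriction makes \<open>h\<close> extensional, as \<open>cochains\<close>
      demands, and changes no value on \<open>carrier A\<close>.\<close>
    let ?h = "\<lambda>(\<psi>, as) \<in> trees 1 \<times> tuples A 1. h (as ! 0)"
    have hv: "?h (Node [Leaf, Leaf], [a]) = h a" if "a \<in> carrier A" for a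
      using that by (simp add: trees_1 tuples_1)
    with h have "?C (\<lambda>a. ?h (Node [Leaf, Leaf], [a]))"
      by (simp add: linear_map_def Pi_def)
    moreover from this have "?h \<in> cochains K A M 1" unfolding cochains_1 by blast
    ultimately show "\<exists>h\<in>cochains K A M 1. ?d = coboundary K A M 1 h" using eq by blast
  qed (use eq in blast)
  moreover have "coboundaries K A M 2 = coboundary K A M 1 ` cochains K A M 1"
    by (simp add: coboundaries_def One_nat_def)
  ultimately show ?thesis using fg by (simp add: cohomologous_def image_iff)
qed (auto simp: cohomologous_def)

text \<open>The zero map witnesses reflexivity. If two cocycles are related to a common third one,
  the difference of the witnesses relates them to each other; this Euclidean property and
  reflexivity yield symmetry and transitivity.\<close>

lemma cohomologous_equiv: "equiv (cocycles K A M 2) (cohomologous K A M 2)"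
proof -
  let ?R = "cohomologous K A M 2"
  have refl: "(f, f) \<in> ?R" if f: "f \<in> cocycles K A M 2" for f
  proof -
    have "linear_map K A M (\<lambda>_. \<zero>\<^bsub>M\<^esub>)" by (auto intro: linear_mapI)
    then show ?thesis unfolding cohomologous_2 using f cocycles_cochains[OF f] by force
  qed
  have eucl: "(f, g) \<in> ?R" if fk: "(f, k) \<in> ?R" and gk: "(g, k) \<in> ?R" for f g k
  proof -
    from fk gk have coc: "f \<in> cocycles K A M 2" "g \<in> cocycles K A M 2" "k \<in> cocycles K A M 2"
      by (simp_all add: cohomologous_2)
    note coch = coc[THEN cocycles_cochains]
    from fk obtain h where h: "linear_map K A M h"
      and fh: "\<And>p a b. a \<in> carrier A \<Longrightarrow> b \<in> carrier A \<Longrightarrow>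
        f (op_tree p, [a, b]) \<oplus>\<^bsub>M\<^esub> h (tprod A p a b) =
        lact M p a (h b) \<oplus>\<^bsub>M\<^esub> ract M p (h a) b \<oplus>\<^bsub>M\<^esub> k (op_tree p, [a, b])"
      by (auto simp: cohomologous_2)
    from gk obtain l where l: "linear_map K A M l"
      and gl: "\<And>p a b. a \<in> carrier A \<Longrightarrow> b \<in> carrier A \<Longrightarrow>
        g (op_tree p, [a, b]) \<oplus>\<^bsub>M\<^esub> l (tprod A p a b) =
        lact M p a (l b) \<oplus>\<^bsub>M\<^esub> ract M p (l a) b \<oplus>\<^bsub>M\<^esub> k (op_tree p, [a, b])"
      by (auto simp: cohomologous_2)
    let ?d = "\<lambda>a. h a \<ominus>\<^bsub>M\<^esub> l a"
    \<comment> \<open>Writing \<open>h\<close> as \<open>?d\<close> plus \<open>l\<close> avoids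
      negatives inside the actions.\<close>
    have lc: "h a \<in> carrier M" "l a \<in> carrier M" "?d a \<in> carrier M" "h a = ?d a \<oplus>\<^bsub>M\<^esub> l a"
      if "a \<in> carrier A" for a
      using that linear_map_closed[OF h that] linear_map_closed[OF l that]
      by (auto simp: a_minus_def M.M.a_assoc M.M.l_neg)
    have "f (op_tree p, [a, b]) \<oplus>\<^bsub>M\<^esub> ?d (tprod A p a b) =
        lact M p a (?d b) \<oplus>\<^bsub>M\<^esub> ract M p (?d a) b \<oplus>\<^bsub>M\<^esub> g (op_tree p, [a, b])"
      if ab: "a \<in> carrier A" "b \<in> carrier A" for p a b
    proof -
      define la lb lab da db dab where l_defs: "la = l a" "lb = l b" "lab = l (tprod A p a b)"
        "da = ?d a" "db = ?d b" "dab = ?d (tprod A p a b)"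
      have c: "la \<in> carrier M" "lb \<in> carrier M" "lab \<in> carrier M" "da \<in> carrier M" "db \<in> carrier M"
        "dab \<in> carrier M" "h a = da \<oplus>\<^bsub>M\<^esub> la" "h b = db \<oplus>\<^bsub>M\<^esub> lb" "h (tprod A p a b) = dab \<oplus>\<^bsub>M\<^esub> lab"
        using ab lc unfolding l_defs by auto
      define F G L where FGL: "F = f (op_tree p, [a, b])" "G = g (op_tree p, [a, b])"
        "L = lact M p a db \<oplus>\<^bsub>M\<^esub> ract M p da b"
      have FGL': "F \<in> carrier M" "G \<in> carrier M" "L \<in> carrier M" using ab coch c by (auto simp: FGL)
      \<comment> \<open>Both sides are computed with \<open>lab\<close> added: the cochain
        \<open>k\<close> enters through \<open>fh\<close>, is eliminated through \<open>gl\<close>,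
        and \<open>lab\<close> is cancelled at the end.\<close>
      have "(F \<oplus>\<^bsub>M\<^esub> dab) \<oplus>\<^bsub>M\<^esub> lab = lact M p a (db \<oplus>\<^bsub>M\<^esub> lb) \<oplus>\<^bsub>M\<^esub> ract M p (da \<oplus>\<^bsub>M\<^esub> la) b
          \<oplus>\<^bsub>M\<^esub> k (op_tree p, [a, b])"
        using fh[OF ab, of p] FGL' c by (simp add: FGL M.M.a_assoc)
      also have "\<dots> = L \<oplus>\<^bsub>M\<^esub> (lact M p a lb \<oplus>\<^bsub>M\<^esub> ract M p la b \<oplus>\<^bsub>M\<^esub> k (op_tree p, [a, b]))"
        using ab c coch by (simp add: FGL act_simps M.M.a_ac)
      also have "\<dots> = (L \<oplus>\<^bsub>M\<^esub> G) \<oplus>\<^bsub>M\<^esub> lab"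
        using gl[OF ab, of p, symmetric] FGL' c by (simp add: FGL(2) l_defs[symmetric] M.M.a_assoc)
      finally have "F \<oplus>\<^bsub>M\<^esub> dab = L \<oplus>\<^bsub>M\<^esub> G" using FGL' c by simp
      then show ?thesis by (simp only: FGL l_defs)
    qed
    with M.linear_map_diff[OF A.module_axioms h l] coc show ?thesis
      unfolding cohomologous_2 by blast
  qed
  show ?thesis
  proof (rule equivI)
    show "?R \<subseteq> cocycles K A M 2 \<times> cocycles K A M 2" by (auto simp: cohomologous_2)
    show "refl_on (cocycles K A M 2) ?R" using refl by (auto simp: refl_on_def)
    have sym: "(g, f) \<in> ?R" if "(f, g) \<in> ?R" for f g
      using eucl[OF refl that] that by (simp add: cohomologous_2)
    then show "sym ?R" by (rule symI)
    show "trans ?R" using eucl sym by (blast intro: transI)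
  qed
qed

end

section \<open>Split extensions\<close>

locale abelian_extension = trias_rep_data K A M
  for K :: "('k, 'x) ring_scheme"
    and A :: "('k, 'a, 'y) trialg_scheme"
    and M :: "('k, 'm, 'a, 'z) trirep_scheme" +
  fixes \<xi> :: "('k, 'm, 'a, 'e) extn"
  assumes extension: "\<xi> \<in> abelian_extensions K A M"
begin

sublocale E: module K "mid \<xi>"
  using extension by (simp add: abelian_extensions_def trias_algebra_def)

lemma mid_bilinear: "bilinear_map K (mid \<xi>) (mid \<xi>) (mid \<xi>) (tprod (mid \<xi>) p)"
  and mid_assoc: "(p, q, r, s) \<in> trias_axioms \<Longrightarrow> u \<in> carrier (mid \<xi>) \<Longrightarrow> v \<in> carrier (mid \<xi>) \<Longrightarrow>
    w \<in> carrier (mid \<xi>) \<Longrightarrow>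
    tprod (mid \<xi>) q (tprod (mid \<xi>) p u v) w = tprod (mid \<xi>) r u (tprod (mid \<xi>) s v w)"
  using extension by (auto simp: abelian_extensions_def trias_algebra_def)

lemmas mid_add = bilinear_map_add_left[OF mid_bilinear] bilinear_map_add_right[OF mid_bilinear]
lemmas mid_smult = bilinear_map_smult_left[OF mid_bilinear] bilinear_map_smult_right[OF mid_bilinear]

text \<open>\<open>inc_inc\<close> is multiplicativity of the inclusion: all products in
  \<open>abelian_trialg M\<close> are zero.\<close>

lemma inc_linear: "linear_map K M (mid \<xi>) (inc \<xi>)"
  and inc_inj: "inj_on (inc \<xi>) (carrier M)"
  and inc_inc: "m \<in> carrier M \<Longrightarrow> n \<in> carrier M \<Longrightarrow>
    tprod (mid \<xi>) p (inc \<xi> m) (inc \<xi> n) = \<zero>\<^bsub>mid \<xi>\<^esub>"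
proof -
  have h: "trias_hom K (abelian_trialg M) (mid \<xi>) (inc \<xi>)"
    using extension by (simp add: abelian_extensions_def)
  then show lin: "linear_map K M (mid \<xi>) (inc \<xi>)"
    by (simp add: trias_hom_def linear_map_def abelian_trialg_def)
  show "tprod (mid \<xi>) p (inc \<xi> m) (inc \<xi> n) = \<zero>\<^bsub>mid \<xi>\<^esub>" if "m \<in> carrier M" "n \<in> carrier M"
    using h that linear_map_zero[OF M.module_axioms E.module_axioms lin]
    by (auto simp: trias_hom_def abelian_trialg_def)
  show "inj_on (inc \<xi>) (carrier M)" using extension by (simp add: abelian_extensions_def)
qed

lemma prj_linear: "linear_map K (mid \<xi>) A (prj \<xi>)"
  and prj_tprod [simp]: "e \<in> carrier (mid \<xi>) \<Longrightarrow> e' \<in> carrier (mid \<xi>) \<Longrightarrow>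
    prj \<xi> (tprod (mid \<xi>) p e e') = tprod A p (prj \<xi> e) (prj \<xi> e')"
  using extension by (simp_all add: abelian_extensions_def trias_hom_def)

lemma prj_surj: "prj \<xi> ` carrier (mid \<xi>) = carrier A"
  and exact: "inc \<xi> ` carrier M = {e \<in> carrier (mid \<xi>). prj \<xi> e = \<zero>\<^bsub>A\<^esub>}"
  and tprod_inc: "e \<in> carrier (mid \<xi>) \<Longrightarrow> m \<in> carrier M \<Longrightarrow>
    tprod (mid \<xi>) p e (inc \<xi> m) = inc \<xi> (lact M p (prj \<xi> e) m)"
    "e \<in> carrier (mid \<xi>) \<Longrightarrow> m \<in> carrier M \<Longrightarrow>
    tprod (mid \<xi>) p (inc \<xi> m) e = inc \<xi> (ract M p m (prj \<xi> e))"
  using extension by (simp_all add: abelian_extensions_def)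

lemma prj_inc [simp]: "m \<in> carrier M \<Longrightarrow> prj \<xi> (inc \<xi> m) = \<zero>\<^bsub>A\<^esub>"
  using exact by blast

lemmas mid_closed [simp] = bilinear_map_closed[OF mid_bilinear] linear_map_closed[OF inc_linear]
  linear_map_closed[OF prj_linear]

text \<open>Only the linear structure is split. A splitting may fail to respect the products, and
  the cocycle measures this failure.\<close>

lemma splitting_exists: "\<exists>\<sigma>. linear_splitting K A \<xi> \<sigma>"
  using linear_section_exists[OF K E.module_axioms A.module_axioms prj_linear prj_surj]
  by (simp add: linear_splitting_def)

end

locale split_extension = abelian_extension K A M \<xi>
  for K :: "('k, 'x) ring_scheme"
    and A :: "('k, 'a, 'y) trialg_scheme"
    and M :: "('k, 'm, 'a, 'z) trirep_scheme"
    and \<xi> :: "('k, 'm, 'a, 'e) extn" +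
  fixes \<sigma> :: "'a \<Rightarrow> 'e"
  assumes splitting: "linear_splitting K A \<xi> \<sigma>"
begin

section \<open>Coordinates on the middle term given by a splitting\<close>

lemma section_linear: "linear_map K A (mid \<xi>) \<sigma>"
  and prj_section [simp]: "a \<in> carrier A \<Longrightarrow> prj \<xi> (\<sigma> a) = a"
  using splitting by (simp_all add: linear_splitting_def)

lemma section_closed [simp]: "a \<in> carrier A \<Longrightarrow> \<sigma> a \<in> carrier (mid \<xi>)"
  by (rule linear_map_closed[OF section_linear])

lemma prj_add_section [simp]:
  "m \<in> carrier M \<Longrightarrow> a \<in> carrier A \<Longrightarrow> prj \<xi> (inc \<xi> m \<oplus>\<^bsub>mid \<xi>\<^esub> \<sigma> a) = a"
  by (simp add: linear_map_add[OF prj_linear])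

text \<open>Subtracting the lift of its projection moves \<open>e\<close> into the kernel of
  \<open>prj\<close>, which by exactness is the image of \<open>inc\<close>.\<close>

lemma decompose:
  assumes e: "e \<in> carrier (mid \<xi>)"
  shows "\<exists>m\<in>carrier M. e = inc \<xi> m \<oplus>\<^bsub>mid \<xi>\<^esub> \<sigma> (prj \<xi> e)"
proof -
  have "prj \<xi> (e \<ominus>\<^bsub>mid \<xi>\<^esub> \<sigma> (prj \<xi> e)) = \<zero>\<^bsub>A\<^esub>"
    using e by (simp add: linear_map_minus[OF E.module_axioms A.module_axioms prj_linear]
        A.M.minus_eq_iff)
  moreover have "e \<ominus>\<^bsub>mid \<xi>\<^esub> \<sigma> (prj \<xi> e) \<in> carrier (mid \<xi>)" using e by simp
  ultimately obtain m where "m \<in> carrier M" "e \<ominus>\<^bsub>mid \<xi>\<^esub> \<sigma> (prj \<xi> e) = inc \<xi> m"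
    using exact by blast
  with e show ?thesis by (intro bexI[of _ m]) (simp_all add: E.M.minus_eq_iff)
qed

lemma decompose_unique:
  assumes "inc \<xi> m \<oplus>\<^bsub>mid \<xi>\<^esub> \<sigma> a = inc \<xi> n \<oplus>\<^bsub>mid \<xi>\<^esub> \<sigma> b"
    and mem: "m \<in> carrier M" "n \<in> carrier M" "a \<in> carrier A" "b \<in> carrier A"
  shows "m = n" "a = b"
proof -
  show "a = b" using arg_cong[OF assms(1), of "prj \<xi>"] mem by simp
  then have "inc \<xi> m = inc \<xi> n" using assms by simp
  then show "m = n" using inc_inj mem by (simp add: inj_on_eq_iff)
qed

text \<open>Of the four terms of the bilinear expansion, the product of the two elements of M
  vanishes, and the two mixed ones are the given actions, because they depend only on the projection
  to A.\<close>

lemma tprod_decomposed: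
  assumes "m \<in> carrier M" "n \<in> carrier M" "a \<in> carrier A" "b \<in> carrier A"
  shows "tprod (mid \<xi>) p (inc \<xi> m \<oplus>\<^bsub>mid \<xi>\<^esub> \<sigma> a) (inc \<xi> n \<oplus>\<^bsub>mid \<xi>\<^esub> \<sigma> b) =
    inc \<xi> (ract M p m b \<oplus>\<^bsub>M\<^esub> lact M p a n) \<oplus>\<^bsub>mid \<xi>\<^esub> tprod (mid \<xi>) p (\<sigma> a) (\<sigma> b)"
  using assms
  by (simp add: mid_add inc_inc tprod_inc linear_map_add[OF inc_linear] linear_map_add[OF prj_linear]
      E.M.a_ac)

text \<open>By \<open>tprod_decomposed\<close> the terms in \<open>m\<close> and \<open>n\<close>
  occur on both sides and cancel, so only products of two lifts carry information about
  \<open>f\<close>.\<close>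

lemma describes_products_iff:
  "describes_products K A M \<xi> \<sigma> f \<longleftrightarrow> f \<in> cochains K A M 2 \<and>
    (\<forall>p. \<forall>a\<in>carrier A. \<forall>b\<in>carrier A.
      tprod (mid \<xi>) p (\<sigma> a) (\<sigma> b) = inc \<xi> (f (op_tree p, [a, b])) \<oplus>\<^bsub>mid \<xi>\<^esub> \<sigma> (tprod A p a b))"
  (is "_ \<longleftrightarrow> _ \<and> ?P")
proof (cases "f \<in> cochains K A M 2")
  case f: True
  have eq: "tprod (mid \<xi>) p (inc \<xi> m \<oplus>\<^bsub>mid \<xi>\<^esub> \<sigma> a) (inc \<xi> n \<oplus>\<^bsub>mid \<xi>\<^esub> \<sigma> b) =
        inc \<xi> (ract M p m b \<oplus>\<^bsub>M\<^esub> lact M p a n \<oplus>\<^bsub>M\<^esub> f (op_tree p, [a, b]))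
          \<oplus>\<^bsub>mid \<xi>\<^esub> \<sigma> (tprod A p a b) \<longleftrightarrow>
      tprod (mid \<xi>) p (\<sigma> a) (\<sigma> b) = inc \<xi> (f (op_tree p, [a, b])) \<oplus>\<^bsub>mid \<xi>\<^esub> \<sigma> (tprod A p a b)"
    if "m \<in> carrier M" "n \<in> carrier M" "a \<in> carrier A" "b \<in> carrier A" for p m n a b
    using that f
    by (simp add: tprod_decomposed linear_map_add[OF inc_linear, of "_ \<oplus>\<^bsub>M\<^esub> _"] E.M.a_assoc)
  \<comment> \<open>Some element of M is required to specialise the quantifiers over
    \<open>m\<close> and \<open>n\<close>.\<close>
  have "\<zero>\<^bsub>M\<^esub> \<in> carrier M" by simp
  with f show ?thesis unfolding describes_products_def using eq by blast
qed (simp add: describes_products_def)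

text \<open>The product of two lifts and the lift of the product lie over the same element of A, so
  they differ by an element of M; this defect is \<open>F\<close>.\<close>

lemma describes_products_exists: "\<exists>!f. describes_products K A M \<xi> \<sigma> f"
proof -
  define F where "F p a b = (SOME m. m \<in> carrier M \<and>
    tprod (mid \<xi>) p (\<sigma> a) (\<sigma> b) = inc \<xi> m \<oplus>\<^bsub>mid \<xi>\<^esub> \<sigma> (tprod A p a b))" for p a b
  have F: "F p a b \<in> carrier M"
    and F_eq: "tprod (mid \<xi>) p (\<sigma> a) (\<sigma> b) = inc \<xi> (F p a b) \<oplus>\<^bsub>mid \<xi>\<^esub> \<sigma> (tprod A p a b)"
    if "a \<in> carrier A" "b \<in> carrier A" for p a b
  proof -
    have "\<exists>m. m \<in> carrier M \<and>
        tprod (mid \<xi>) p (\<sigma> a) (\<sigma> b) = inc \<xi> m \<oplus>\<^bsub>mid \<xi>\<^esub> \<sigma> (tprod A p a b)"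
      using that decompose[of "tprod (mid \<xi>) p (\<sigma> a) (\<sigma> b)"] by auto
    from someI_ex[OF this] show "F p a b \<in> carrier M"
      "tprod (mid \<xi>) p (\<sigma> a) (\<sigma> b) = inc \<xi> (F p a b) \<oplus>\<^bsub>mid \<xi>\<^esub> \<sigma> (tprod A p a b)"
      unfolding F_def by auto
  qed
  \<comment> \<open>Each linearity law for \<open>F\<close> follows by exhibiting its right-hand
    side as an M-part of the element whose M-part is the left-hand side.\<close>
  have F_unique: "F p a b = m" if "a \<in> carrier A" "b \<in> carrier A" "m \<in> carrier M"
    "tprod (mid \<xi>) p (\<sigma> a) (\<sigma> b) = inc \<xi> m \<oplus>\<^bsub>mid \<xi>\<^esub> \<sigma> (tprod A p a b)" for p a b m
    using that F by (intro decompose_unique(1)[of _ "tprod A p a b" _ "tprod A p a b"]) (simp_all add: F_eq)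
  have "bilinear_map K A A M (F p)" for p
    by (rule bilinear_mapI)
      (simp_all add: F F_unique F_eq mid_add mid_smult act_simps linear_map_add[OF section_linear]
        linear_map_smult[OF section_linear] linear_map_add[OF inc_linear]
        linear_map_smult[OF inc_linear] E.smult_r_distr E.M.a_ac)
  from cochain_2_exists[of F, OF this] obtain f where "f \<in> cochains K A M 2"
    "\<And>p a b. a \<in> carrier A \<Longrightarrow> b \<in> carrier A \<Longrightarrow> f (op_tree p, [a, b]) = F p a b" by blast
  then have f: "describes_products K A M \<xi> \<sigma> f" by (simp add: describes_products_iff F_eq)
  show ?thesis
  proof (rule ex1I, rule f)
    fix g assume g: "describes_products K A M \<xi> \<sigma> g"
    show "g = f"
    proof (rule cochain_2_eqI)
      show "g \<in> cochains K A M 2" "f \<in> cochains K A M 2"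
        using f g by (simp_all add: describes_products_iff)
      then show "g (op_tree p, [a, b]) = f (op_tree p, [a, b])"
        if "a \<in> carrier A" "b \<in> carrier A" for p a b
        using that f g unfolding describes_products_iff
        by (metis closed(1) cochain_closed decompose_unique(1))
    qed
  qed
qed

lemma describes_products_cocycle:
  assumes f: "describes_products K A M \<xi> \<sigma> f"
  shows "f \<in> cocycles K A M 2"
proof -
  have fc: "f \<in> cochains K A M 2" using f by (simp add: describes_products_iff)
  have sec: "tprod (mid \<xi>) p (\<sigma> a) (\<sigma> b) = inc \<xi> (f (op_tree p, [a, b])) \<oplus>\<^bsub>mid \<xi>\<^esub> \<sigma> (tprod A p a b)"
    if "a \<in> carrier A" "b \<in> carrier A" for p a b
    using f that by (simp add: describes_products_iff)
  \<comment> \<open>In an iterated product one factor is a lift plus an element of M; these rules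
    multiply it by a lift from either side.\<close>
  have left: "tprod (mid \<xi>) p (inc \<xi> m \<oplus>\<^bsub>mid \<xi>\<^esub> \<sigma> a) (\<sigma> b) =
      inc \<xi> (ract M p m b \<oplus>\<^bsub>M\<^esub> f (op_tree p, [a, b])) \<oplus>\<^bsub>mid \<xi>\<^esub> \<sigma> (tprod A p a b)"
    and right: "tprod (mid \<xi>) p (\<sigma> b) (inc \<xi> m \<oplus>\<^bsub>mid \<xi>\<^esub> \<sigma> a) =
      inc \<xi> (lact M p b m \<oplus>\<^bsub>M\<^esub> f (op_tree p, [b, a])) \<oplus>\<^bsub>mid \<xi>\<^esub> \<sigma> (tprod A p b a)"
    if "m \<in> carrier M" "a \<in> carrier A" "b \<in> carrier A" for p m a b
    using that fc
    by (simp_all add: mid_add tprod_inc sec linear_map_add[OF inc_linear] E.M.a_ac)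
  show ?thesis
    unfolding cocycles_2
  proof (intro conjI fc ballI, clarify)
    fix p q r s x y z
    assume ax: "(p, q, r, s) \<in> trias_axioms"
      and xyz: "x \<in> carrier A" "y \<in> carrier A" "z \<in> carrier A"
    then have "tprod (mid \<xi>) q (tprod (mid \<xi>) p (\<sigma> x) (\<sigma> y)) (\<sigma> z) =
      tprod (mid \<xi>) r (\<sigma> x) (tprod (mid \<xi>) s (\<sigma> y) (\<sigma> z))"
      by (simp add: mid_assoc)
    with xyz fc have "inc \<xi> (ract M q (f (op_tree p, [x, y])) z \<oplus>\<^bsub>M\<^esub> f (op_tree q, [tprod A p x y, z]))
        \<oplus>\<^bsub>mid \<xi>\<^esub> \<sigma> (tprod A q (tprod A p x y) z) =
      inc \<xi> (lact M r x (f (op_tree s, [y, z])) \<oplus>\<^bsub>M\<^esub> f (op_tree r, [x, tprod A s y z]))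
        \<oplus>\<^bsub>mid \<xi>\<^esub> \<sigma> (tprod A r x (tprod A s y z))"
      by (simp add: sec left right)
    then show "ract M q (f (op_tree p, [x, y])) z \<oplus>\<^bsub>M\<^esub> f (op_tree q, [tprod A p x y, z]) =
      lact M r x (f (op_tree s, [y, z])) \<oplus>\<^bsub>M\<^esub> f (op_tree r, [x, tprod A s y z])"
      \<comment> \<open>The M-parts are compared without matching the A-parts beforehand.\<close>
      by (rule decompose_unique) (use xyz fc in simp_all)
  qed
qed

lemma ext_cocycle_describes: "describes_products K A M \<xi> \<sigma> (ext_cocycle K A M \<xi> \<sigma>)"
  unfolding ext_cocycle_def by (rule theI'[OF describes_products_exists])

end

section \<open>Morphisms of extensions and coboundaries\<close>

context trias_rep_data
begin

text \<open>The middle terms may have different types; this allows the twisted product on pairs to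
  be compared with an extension in the universe. On M a morphism is prescribed, so it is determined
  by its values on lifts.\<close>

lemma ext_equivalent_iff_cohomologous:
  assumes \<xi>: "\<xi> \<in> abelian_extensions K A M" "linear_splitting K A \<xi> \<sigma>"
    and \<xi>': "\<xi>' \<in> abelian_extensions K A M" "linear_splitting K A \<xi>' \<sigma>'"
    and f: "describes_products K A M \<xi> \<sigma> f" and f': "describes_products K A M \<xi>' \<sigma>' f'"
  shows "ext_equivalent K M \<xi> \<xi>' \<longleftrightarrow> (f, f') \<in> cohomologous K A M 2"
proof -
  interpret X: split_extension K A M \<xi> \<sigma> by unfold_locales (fact \<xi>)+
  interpret Y: split_extension K A M \<xi>' \<sigma>' by unfold_locales (fact \<xi>')+
  have coc: "f \<in> cocycles K A M 2" "f' \<in> cocycles K A M 2"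
    using X.describes_products_cocycle[OF f] Y.describes_products_cocycle[OF f'] .
  note coch [simp] = coc[THEN cocycles_cochains]
  have sec: "tprod (mid \<xi>) p (\<sigma> a) (\<sigma> b) = inc \<xi> (f (op_tree p, [a, b])) \<oplus>\<^bsub>mid \<xi>\<^esub> \<sigma> (tprod A p a b)"
    if "a \<in> carrier A" "b \<in> carrier A" for p a b
    using f that by (simp add: X.describes_products_iff)
  have dec: "tprod (mid \<xi>) p (inc \<xi> m \<oplus>\<^bsub>mid \<xi>\<^esub> \<sigma> a) (inc \<xi> n \<oplus>\<^bsub>mid \<xi>\<^esub> \<sigma> b) =
      inc \<xi> (ract M p m b \<oplus>\<^bsub>M\<^esub> lact M p a n \<oplus>\<^bsub>M\<^esub> f (op_tree p, [a, b])) \<oplus>\<^bsub>mid \<xi>\<^esub> \<sigma> (tprod A p a b)"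
    if "m \<in> carrier M" "n \<in> carrier M" "a \<in> carrier A" "b \<in> carrier A" for p m n a b
    using f that by (simp add: describes_products_def)
  have dec': "tprod (mid \<xi>') p (inc \<xi>' m \<oplus>\<^bsub>mid \<xi>'\<^esub> \<sigma>' a) (inc \<xi>' n \<oplus>\<^bsub>mid \<xi>'\<^esub> \<sigma>' b) =
      inc \<xi>' (ract M p m b \<oplus>\<^bsub>M\<^esub> lact M p a n \<oplus>\<^bsub>M\<^esub> f' (op_tree p, [a, b])) \<oplus>\<^bsub>mid \<xi>'\<^esub> \<sigma>' (tprod A p a b)"
    if "m \<in> carrier M" "n \<in> carrier M" "a \<in> carrier A" "b \<in> carrier A" for p m n a b
    using f' that by (simp add: describes_products_def)
  show ?thesis
  proof
    assume "ext_equivalent K M \<xi> \<xi>'"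
    then obtain \<phi> where lin: "linear_map K (mid \<xi>) (mid \<xi>') \<phi>"
      and mult: "\<And>p u v. u \<in> carrier (mid \<xi>) \<Longrightarrow> v \<in> carrier (mid \<xi>) \<Longrightarrow>
        \<phi> (tprod (mid \<xi>) p u v) = tprod (mid \<xi>') p (\<phi> u) (\<phi> v)"
      and inc: "\<And>m. m \<in> carrier M \<Longrightarrow> \<phi> (inc \<xi> m) = inc \<xi>' m"
      and prj: "\<And>e. e \<in> carrier (mid \<xi>) \<Longrightarrow> prj \<xi>' (\<phi> e) = prj \<xi> e"
      unfolding ext_equivalent_def trias_hom_def by blast
    \<comment> \<open>The image of a lift of \<open>a\<close> again lies over \<open>a\<close>, so
      relative to \<sigma>' only its M-part is free.\<close>
    have "\<exists>m\<in>carrier M. \<phi> (\<sigma> a) = inc \<xi>' m \<oplus>\<^bsub>mid \<xi>'\<^esub> \<sigma>' a" if "a \<in> carrier A" for a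
      using that Y.decompose[of "\<phi> (\<sigma> a)"] linear_map_closed[OF lin] by (simp add: prj)
    then obtain h where h: "\<And>a. a \<in> carrier A \<Longrightarrow> h a \<in> carrier M"
      and h_eq: "\<And>a. a \<in> carrier A \<Longrightarrow> \<phi> (\<sigma> a) = inc \<xi>' (h a) \<oplus>\<^bsub>mid \<xi>'\<^esub> \<sigma>' a"
      by metis
    have h_unique: "h a = m" if "a \<in> carrier A" "m \<in> carrier M"
      "\<phi> (\<sigma> a) = inc \<xi>' m \<oplus>\<^bsub>mid \<xi>'\<^esub> \<sigma>' a" for a m
      using that h by (intro Y.decompose_unique(1)[of _ a _ a]) (simp_all add: h_eq)
    have "linear_map K A M h"
      by (rule linear_mapI)
        (simp_all add: h h_unique h_eq linear_map_add[OF X.section_linear]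
          linear_map_add[OF Y.section_linear] linear_map_add[OF lin] linear_map_add[OF Y.inc_linear]
          linear_map_smult[OF X.section_linear] linear_map_smult[OF Y.section_linear]
          linear_map_smult[OF lin] linear_map_smult[OF Y.inc_linear] Y.E.smult_r_distr Y.E.M.a_ac)
    moreover have "f (op_tree p, [a, b]) \<oplus>\<^bsub>M\<^esub> h (tprod A p a b) =
        lact M p a (h b) \<oplus>\<^bsub>M\<^esub> ract M p (h a) b \<oplus>\<^bsub>M\<^esub> f' (op_tree p, [a, b])"
      if ab: "a \<in> carrier A" "b \<in> carrier A" for p a b
    proof -
      \<comment> \<open>\<phi> is evaluated at a product of lifts in two ways: by decomposing the
        product in \<xi>, and by multiplying the images in \<xi>'.\<close>
      have "inc \<xi>' (f (op_tree p, [a, b]) \<oplus>\<^bsub>M\<^esub> h (tprod A p a b)) \<oplus>\<^bsub>mid \<xi>'\<^esub> \<sigma>' (tprod A p a b) =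
          \<phi> (tprod (mid \<xi>) p (\<sigma> a) (\<sigma> b))"
        using ab h by (simp add: sec linear_map_add[OF lin] inc h_eq linear_map_add[OF Y.inc_linear]
            Y.E.M.a_assoc)
      also have "\<dots> = inc \<xi>' (ract M p (h a) b \<oplus>\<^bsub>M\<^esub> lact M p a (h b) \<oplus>\<^bsub>M\<^esub> f' (op_tree p, [a, b]))
          \<oplus>\<^bsub>mid \<xi>'\<^esub> \<sigma>' (tprod A p a b)"
        using ab h by (simp add: mult h_eq dec')
      finally have "f (op_tree p, [a, b]) \<oplus>\<^bsub>M\<^esub> h (tprod A p a b) =
          ract M p (h a) b \<oplus>\<^bsub>M\<^esub> lact M p a (h b) \<oplus>\<^bsub>M\<^esub> f' (op_tree p, [a, b])"
        by (rule Y.decompose_unique) (use ab h in simp_all)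
      then show ?thesis using ab h by (simp add: M.M.a_ac)
    qed
    ultimately show "(f, f') \<in> cohomologous K A M 2"
      unfolding cohomologous_2 using coc by blast
  next
    assume "(f, f') \<in> cohomologous K A M 2"
    then obtain h where lin: "linear_map K A M h"
      and h_eq: "\<And>p a b. a \<in> carrier A \<Longrightarrow> b \<in> carrier A \<Longrightarrow>
        f (op_tree p, [a, b]) \<oplus>\<^bsub>M\<^esub> h (tprod A p a b) =
        lact M p a (h b) \<oplus>\<^bsub>M\<^esub> ract M p (h a) b \<oplus>\<^bsub>M\<^esub> f' (op_tree p, [a, b])"
      by (auto simp: cohomologous_2)
    note h [simp] = linear_map_closed[OF lin]
    have "\<forall>e\<in>carrier (mid \<xi>). \<exists>m\<in>carrier M. e = inc \<xi> m \<oplus>\<^bsub>mid \<xi>\<^esub> \<sigma> (prj \<xi> e)"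
      using X.decompose by blast
    then obtain \<mu> where \<mu> [simp]: "\<And>e. e \<in> carrier (mid \<xi>) \<Longrightarrow> \<mu> e \<in> carrier M"
      and \<mu>_eq: "\<And>e. e \<in> carrier (mid \<xi>) \<Longrightarrow> e = inc \<xi> (\<mu> e) \<oplus>\<^bsub>mid \<xi>\<^esub> \<sigma> (prj \<xi> e)"
      by metis
    \<comment> \<open>\<open>\<mu>\<close> is the M-part relative to \<sigma>, so in coordinates
      \<phi> is the shear taking (m, a) to (m + h a, a).\<close>
    define \<phi> where "\<phi> e = inc \<xi>' (\<mu> e \<oplus>\<^bsub>M\<^esub> h (prj \<xi> e)) \<oplus>\<^bsub>mid \<xi>'\<^esub> \<sigma>' (prj \<xi> e)" for e
    have \<phi>: "\<phi> (inc \<xi> m \<oplus>\<^bsub>mid \<xi>\<^esub> \<sigma> a) = inc \<xi>' (m \<oplus>\<^bsub>M\<^esub> h a) \<oplus>\<^bsub>mid \<xi>'\<^esub> \<sigma>' a"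
      if ma: "m \<in> carrier M" "a \<in> carrier A" for m a
    proof -
      have "m = \<mu> (inc \<xi> m \<oplus>\<^bsub>mid \<xi>\<^esub> \<sigma> a)"
        using ma \<mu>_eq[of "inc \<xi> m \<oplus>\<^bsub>mid \<xi>\<^esub> \<sigma> a"]
        by (intro X.decompose_unique(1)[of _ a _ a]) simp_all
      then show ?thesis using ma by (simp add: \<phi>_def)
    qed
    have cases: "\<exists>m\<in>carrier M. \<exists>a\<in>carrier A. e = inc \<xi> m \<oplus>\<^bsub>mid \<xi>\<^esub> \<sigma> a" if "e \<in> carrier (mid \<xi>)" for e
      using that X.decompose[OF that] X.mid_closed(3)[OF that] by blast
    have "linear_map K (mid \<xi>) (mid \<xi>') \<phi>"
    proof (rule linear_mapI)
      show "\<phi> e \<in> carrier (mid \<xi>')" if "e \<in> carrier (mid \<xi>)" for e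
        using that by (simp add: \<phi>_def)
    next
      fix u v assume uv: "u \<in> carrier (mid \<xi>)" "v \<in> carrier (mid \<xi>)"
      from cases[OF uv(1)] cases[OF uv(2)] obtain m a n b where
        ma: "m \<in> carrier M" "a \<in> carrier A" "n \<in> carrier M" "b \<in> carrier A"
        and eqs: "u = inc \<xi> m \<oplus>\<^bsub>mid \<xi>\<^esub> \<sigma> a" "v = inc \<xi> n \<oplus>\<^bsub>mid \<xi>\<^esub> \<sigma> b" by blast
      have "u \<oplus>\<^bsub>mid \<xi>\<^esub> v = inc \<xi> (m \<oplus>\<^bsub>M\<^esub> n) \<oplus>\<^bsub>mid \<xi>\<^esub> \<sigma> (a \<oplus>\<^bsub>A\<^esub> b)"
        using ma by (simp add: eqs linear_map_add[OF X.inc_linear] linear_map_add[OF X.section_linear]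
            X.E.M.a_ac)
      then show "\<phi> (u \<oplus>\<^bsub>mid \<xi>\<^esub> v) = \<phi> u \<oplus>\<^bsub>mid \<xi>'\<^esub> \<phi> v"
        using ma by (simp add: eqs \<phi> linear_map_add[OF Y.inc_linear] linear_map_add[OF Y.section_linear]
            linear_map_add[OF lin] Y.E.M.a_ac)
    next
      fix c u assume c: "c \<in> carrier K" and u: "u \<in> carrier (mid \<xi>)"
      from cases[OF u] obtain m a where ma: "m \<in> carrier M" "a \<in> carrier A"
        and eqs: "u = inc \<xi> m \<oplus>\<^bsub>mid \<xi>\<^esub> \<sigma> a" by blast
      have "c \<odot>\<^bsub>mid \<xi>\<^esub> u = inc \<xi> (c \<odot>\<^bsub>M\<^esub> m) \<oplus>\<^bsub>mid \<xi>\<^esub> \<sigma> (c \<odot>\<^bsub>A\<^esub> a)"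
        using ma c by (simp add: eqs linear_map_smult[OF X.inc_linear]
            linear_map_smult[OF X.section_linear] X.E.smult_r_distr)
      then show "\<phi> (c \<odot>\<^bsub>mid \<xi>\<^esub> u) = c \<odot>\<^bsub>mid \<xi>'\<^esub> \<phi> u"
        using ma c by (simp add: eqs \<phi> linear_map_smult[OF Y.inc_linear] linear_map_add[OF Y.inc_linear]
            linear_map_smult[OF Y.section_linear] linear_map_smult[OF lin] Y.E.smult_r_distr)
    qed
    moreover have "\<phi> (tprod (mid \<xi>) p u v) = tprod (mid \<xi>') p (\<phi> u) (\<phi> v)"
      if uv: "u \<in> carrier (mid \<xi>)" "v \<in> carrier (mid \<xi>)" for p u v
    proof -
      from cases[OF uv(1)] cases[OF uv(2)] obtain m a n b where
        ma: "m \<in> carrier M" "a \<in> carrier A" "n \<in> carrier M" "b \<in> carrier A"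
        and eqs: "u = inc \<xi> m \<oplus>\<^bsub>mid \<xi>\<^esub> \<sigma> a" "v = inc \<xi> n \<oplus>\<^bsub>mid \<xi>\<^esub> \<sigma> b" by blast
      have "ract M p m b \<oplus>\<^bsub>M\<^esub> lact M p a n \<oplus>\<^bsub>M\<^esub> f (op_tree p, [a, b]) \<oplus>\<^bsub>M\<^esub> h (tprod A p a b) =
          (ract M p m b \<oplus>\<^bsub>M\<^esub> lact M p a n) \<oplus>\<^bsub>M\<^esub> (f (op_tree p, [a, b]) \<oplus>\<^bsub>M\<^esub> h (tprod A p a b))"
        using ma by (simp add: M.M.a_assoc)
      \<comment> \<open>The correction \<open>h\<close> at the product is absorbed by replacing m
        and n by m + h a and n + h b inside the actions.\<close>
      also have "\<dots> = ract M p (m \<oplus>\<^bsub>M\<^esub> h a) b \<oplus>\<^bsub>M\<^esub> lact M p a (n \<oplus>\<^bsub>M\<^esub> h b) \<oplus>\<^bsub>M\<^esub> f' (op_tree p, [a, b])"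
        unfolding h_eq[OF ma(2,4)] using ma by (simp add: act_simps M.M.a_ac)
      finally show ?thesis using ma by (simp add: eqs dec \<phi> dec')
    qed
    moreover have "\<phi> (inc \<xi> m) = inc \<xi>' m" if "m \<in> carrier M" for m
      using \<phi>[OF that A.M.zero_closed] that
      by (simp add: linear_map_zero[OF A.module_axioms X.E.module_axioms X.section_linear]
          linear_map_zero[OF A.module_axioms Y.E.module_axioms Y.section_linear]
          linear_map_zero[OF A.module_axioms M.module_axioms lin])
    moreover have "prj \<xi>' (\<phi> e) = prj \<xi> e" if "e \<in> carrier (mid \<xi>)" for e
      using that by (simp add: \<phi>_def)
    ultimately show "ext_equivalent K M \<xi> \<xi>'"
      unfolding ext_equivalent_def trias_hom_def by blast
  qed
qed

end

section \<open>Twisted products\<close>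

context trias_rep_data
begin

text \<open>The carrier is only required to be in bijection with the product, so that the twisted
  product can be realised on any type that is large enough.\<close>
lemma twisted_extension:
  fixes j :: "'m \<Rightarrow> 'a \<Rightarrow> 'e" and \<xi> :: "('k, 'm, 'a, 'e) extn"
  assumes g: "g \<in> cocycles K A M 2"
    and carrier: "carrier (mid \<xi>) = (\<lambda>(m, a). j m a) ` (carrier M \<times> carrier A)"
    and prj: "\<And>m a. m \<in> carrier M \<Longrightarrow> a \<in> carrier A \<Longrightarrow> prj \<xi> (j m a) = a"
    and inj: "\<And>m n a. m \<in> carrier M \<Longrightarrow> n \<in> carrier M \<Longrightarrow> a \<in> carrier A \<Longrightarrow> j m a = j n a \<Longrightarrow> m = n"
    and inc: "\<And>m. m \<in> carrier M \<Longrightarrow> inc \<xi> m = j m \<zero>\<^bsub>A\<^esub>"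
    and zero: "\<zero>\<^bsub>mid \<xi>\<^esub> = j \<zero>\<^bsub>M\<^esub> \<zero>\<^bsub>A\<^esub>"
    and add: "\<And>m n a b. m \<in> carrier M \<Longrightarrow> a \<in> carrier A \<Longrightarrow> n \<in> carrier M \<Longrightarrow> b \<in> carrier A \<Longrightarrow>
      j m a \<oplus>\<^bsub>mid \<xi>\<^esub> j n b = j (m \<oplus>\<^bsub>M\<^esub> n) (a \<oplus>\<^bsub>A\<^esub> b)"
    and smult: "\<And>c m a. c \<in> carrier K \<Longrightarrow> m \<in> carrier M \<Longrightarrow> a \<in> carrier A \<Longrightarrow>
      c \<odot>\<^bsub>mid \<xi>\<^esub> j m a = j (c \<odot>\<^bsub>M\<^esub> m) (c \<odot>\<^bsub>A\<^esub> a)"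
    and tprod: "\<And>p m n a b. m \<in> carrier M \<Longrightarrow> a \<in> carrier A \<Longrightarrow> n \<in> carrier M \<Longrightarrow> b \<in> carrier A \<Longrightarrow>
      tprod (mid \<xi>) p (j m a) (j n b) =
      j (ract M p m b \<oplus>\<^bsub>M\<^esub> lact M p a n \<oplus>\<^bsub>M\<^esub> g (op_tree p, [a, b])) (tprod A p a b)"
  shows "\<xi> \<in> abelian_extensions K A M" "linear_splitting K A \<xi> (j \<zero>\<^bsub>M\<^esub>)"
    "describes_products K A M \<xi> (j \<zero>\<^bsub>M\<^esub>) g"
proof -
  have gc [simp]: "g \<in> cochains K A M 2" using g by (rule cocycles_cochains)
  have g_bil: "bilinear_map K A A M (\<lambda>a b. g (op_tree p, [a, b]))" for p
    using gc by (simp add: cochains_2)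
  note g_simps = bilinear_map_add_left[OF g_bil] bilinear_map_add_right[OF g_bil]
    bilinear_map_smult_left[OF g_bil] bilinear_map_smult_right[OF g_bil]
  \<comment> \<open>An element of M has A-part zero, so \<open>g\<close> contributes nothing to
    products with it: M is abelian inside the twisted product, and the induced actions are the given
    ones.\<close>
  have g_zero: "g (op_tree p, [a, \<zero>\<^bsub>A\<^esub>]) = \<zero>\<^bsub>M\<^esub>" "g (op_tree p, [\<zero>\<^bsub>A\<^esub>, a]) = \<zero>\<^bsub>M\<^esub>"
    if "a \<in> carrier A" for p a
    using g_bil[of p] that linear_map_zero[OF A.module_axioms M.module_axioms]
    unfolding bilinear_map_def by blast+
  have mem [simp]: "j m a \<in> carrier (mid \<xi>)" if "m \<in> carrier M" "a \<in> carrier A" for m a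
    using that by (auto simp: carrier)
  have cases: "\<exists>m\<in>carrier M. \<exists>a\<in>carrier A. e = j m a" if "e \<in> carrier (mid \<xi>)" for e
    using that by (auto simp: carrier)
  have ball: "(\<forall>e\<in>carrier (mid \<xi>). P e) \<longleftrightarrow> (\<forall>m\<in>carrier M. \<forall>a\<in>carrier A. P (j m a))" for P
    by (auto simp: carrier)
  have "abelian_group (mid \<xi>)"
  proof (rule abelian_groupI)
    show "\<exists>y\<in>carrier (mid \<xi>). y \<oplus>\<^bsub>mid \<xi>\<^esub> x = \<zero>\<^bsub>mid \<xi>\<^esub>" if x: "x \<in> carrier (mid \<xi>)" for x
    proof -
      from cases[OF x] obtain m a where ma: "m \<in> carrier M" "a \<in> carrier A" "x = j m a" by blast
      then show ?thesis
        by (intro bexI[of _ "j (\<ominus>\<^bsub>M\<^esub> m) (\<ominus>\<^bsub>A\<^esub> a)"]) (simp_all add: add zero M.M.l_neg A.M.l_neg)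
    qed
  qed (auto dest!: cases simp: add zero M.M.a_ac A.M.a_ac)
  then have mod: "module K (mid \<xi>)"
  proof (intro moduleI K.is_cring)
  qed (auto dest!: cases simp: add smult M.smult_l_distr M.smult_r_distr A.smult_l_distr
      A.smult_r_distr M.smult_assoc1 A.smult_assoc1)
  have bil: "bilinear_map K (mid \<xi>) (mid \<xi>) (mid \<xi>) (tprod (mid \<xi>) p)" for p
    by (rule bilinear_mapI)
      (auto dest!: cases simp: tprod add smult act_simps g_simps M.smult_r_distr M.M.a_ac)
  have assoc: "tprod (mid \<xi>) q (tprod (mid \<xi>) p u v) w = tprod (mid \<xi>) r u (tprod (mid \<xi>) s v w)"
    if ax: "(p, q, r, s) \<in> trias_axioms" and uvw: "u \<in> carrier (mid \<xi>)" "v \<in> carrier (mid \<xi>)"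
      "w \<in> carrier (mid \<xi>)" for p q r s u v w
  proof -
    from cases[OF uvw(1)] cases[OF uvw(2)] cases[OF uvw(3)] obtain l x m y n z
      where lmn: "l \<in> carrier M" "m \<in> carrier M" "n \<in> carrier M"
        and xyz: "x \<in> carrier A" "y \<in> carrier A" "z \<in> carrier A"
        and eqs: "u = j l x" "v = j m y" "w = j n z" by blast
    have algebra: "tprod A q (tprod A p x y) z = tprod A r x (tprod A s y z)"
      using A ax xyz by (auto simp: trias_algebra_def)
    \<comment> \<open>There is one identity for each position of the factor from M. No term of the
      twisted product involves two factors from M.\<close>
    have rep: "ract M q (ract M p l y) z = ract M r l (tprod A s y z)"
      "ract M q (lact M p x m) z = lact M r x (ract M s m z)"
      "lact M q (tprod A p x y) n = lact M r x (lact M s y n)"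
      using M[unfolded trias_rep_def, THEN conjunct2, THEN conjunct2, THEN conjunct2, THEN conjunct2,
          THEN bspec, OF ax, unfolded prod.case] xyz lmn by blast+
    have cocycle: "ract M q (g (op_tree p, [x, y])) z \<oplus>\<^bsub>M\<^esub> g (op_tree q, [tprod A p x y, z]) =
        lact M r x (g (op_tree s, [y, z])) \<oplus>\<^bsub>M\<^esub> g (op_tree r, [x, tprod A s y z])"
      using g[unfolded cocycles_2, THEN conjunct2, THEN bspec, OF ax, unfolded prod.case] xyz by blast
    \<comment> \<open>By \<open>rep\<close> the terms in l, m, n agree for both bracketings; the
      remaining pairs of terms in \<open>g\<close> are exchanged by \<open>cocycle\<close>.\<close>
    let ?rep = "ract M r l (tprod A s y z) \<oplus>\<^bsub>M\<^esub> lact M r x (ract M s m z) \<oplus>\<^bsub>M\<^esub> lact M r x (lact M s y n)"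
    have "tprod (mid \<xi>) q (tprod (mid \<xi>) p u v) w = j (?rep \<oplus>\<^bsub>M\<^esub> (ract M q (g (op_tree p, [x, y])) z
        \<oplus>\<^bsub>M\<^esub> g (op_tree q, [tprod A p x y, z]))) (tprod A r x (tprod A s y z))"
      using lmn xyz by (simp add: eqs tprod act_simps rep algebra M.M.a_ac)
    also have "\<dots> = tprod (mid \<xi>) r u (tprod (mid \<xi>) s v w)"
      unfolding cocycle using lmn xyz by (simp add: eqs tprod act_simps M.M.a_ac)
    finally show ?thesis .
  qed
  have alg: "trias_algebra K (mid \<xi>)"
    unfolding trias_algebra_def using K mod bil assoc by blast
  have "trias_hom K (abelian_trialg M) (mid \<xi>) (inc \<xi>)"
    by (auto simp: trias_hom_def linear_map_def abelian_trialg_def inc add smult tprod zero g_zero)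
  moreover have "trias_hom K (mid \<xi>) A (prj \<xi>)"
    by (auto dest!: cases simp: trias_hom_def linear_map_def prj add smult tprod)
  moreover have "inj_on (inc \<xi>) (carrier M)"
    by (rule inj_onI) (auto simp: inc intro: inj)
  moreover have "prj \<xi> ` carrier (mid \<xi>) = carrier A"
    by (force simp: carrier image_image prj)
  moreover have "inc \<xi> ` carrier M = {e \<in> carrier (mid \<xi>). prj \<xi> e = \<zero>\<^bsub>A\<^esub>}"
    by (auto dest!: cases simp: inc prj image_iff)
  ultimately show "\<xi> \<in> abelian_extensions K A M"
    using alg unfolding abelian_extensions_def
    by (simp add: ball inc prj tprod g_zero)
  show "linear_splitting K A \<xi> (j \<zero>\<^bsub>M\<^esub>)"
    by (auto simp: linear_splitting_def linear_map_def prj add smult)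
  show "describes_products K A M \<xi> (j \<zero>\<^bsub>M\<^esub>) g"
    by (simp add: describes_products_def inc add tprod)
qed

text \<open>For the splitting that sends a to (0, a) the describing cochain is \<open>g\<close>
  itself. This is why passing from a cocycle to its extension and back returns its class.\<close>

lemma cocycle_ext_extension:
  assumes "g \<in> cocycles K A M 2"
  shows "cocycle_ext A M g \<in> abelian_extensions K A M"
    "linear_splitting K A (cocycle_ext A M g) (Pair \<zero>\<^bsub>M\<^esub>)"
    "describes_products K A M (cocycle_ext A M g) (Pair \<zero>\<^bsub>M\<^esub>) g"
  by (rule twisted_extension[OF assms, where j = Pair]; auto simp: cocycle_ext_def)+

text \<open>The twisted product is transported along \<open>\<iota>\<close>, so that every
  cohomology class comes from an extension inside the universe.\<close>

lemma cocycle_ext_in_universe: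
  fixes \<iota> :: "'m \<times> 'a \<Rightarrow> 'e"
  assumes g: "g \<in> cocycles K A M 2" and \<iota>: "inj_on \<iota> (carrier M \<times> carrier A)"
  shows "\<exists>(\<xi> :: ('k, 'm, 'a, 'e) extn) \<sigma>. \<xi> \<in> abelian_extensions K A M \<and>
    linear_splitting K A \<xi> \<sigma> \<and> describes_products K A M \<xi> \<sigma> g"
proof -
  let ?Z = "mid (cocycle_ext A M g)"
  \<comment> \<open>The inverse of \<open>\<iota>\<close> on its image pulls arguments back to pairs
    before they are added, scaled or multiplied.\<close>
  define \<kappa> where "\<kappa> = the_inv_into (carrier M \<times> carrier A) \<iota>"
  have \<kappa> [simp]: "\<kappa> (\<iota> (m, a)) = (m, a)" if "m \<in> carrier M" "a \<in> carrier A" for m a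
    unfolding \<kappa>_def using that by (simp add: the_inv_into_f_f[OF \<iota>])
  define \<xi> :: "('k, 'm, 'a, 'e) extn" where "\<xi> =
    \<lparr>mid = \<lparr>carrier = \<iota> ` (carrier M \<times> carrier A), mult = undefined, one = undefined,
       zero = \<iota> (\<zero>\<^bsub>M\<^esub>, \<zero>\<^bsub>A\<^esub>), add = (\<lambda>u v. \<iota> (\<kappa> u \<oplus>\<^bsub>?Z\<^esub> \<kappa> v)),
       smult = (\<lambda>c u. \<iota> (c \<odot>\<^bsub>?Z\<^esub> \<kappa> u)), tprod = (\<lambda>p u v. \<iota> (tprod ?Z p (\<kappa> u) (\<kappa> v)))\<rparr>,
     inc = (\<lambda>m. \<iota> (m, \<zero>\<^bsub>A\<^esub>)), prj = (\<lambda>u. snd (\<kappa> u))\<rparr>"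
  have inj: "m = n" if "m \<in> carrier M" "n \<in> carrier M" "a \<in> carrier A" "\<iota> (m, a) = \<iota> (n, a)" for m n a
    using that \<kappa> by (metis prod.inject)
  have "\<xi> \<in> abelian_extensions K A M \<and> linear_splitting K A \<xi> (\<lambda>a. \<iota> (\<zero>\<^bsub>M\<^esub>, a)) \<and>
      describes_products K A M \<xi> (\<lambda>a. \<iota> (\<zero>\<^bsub>M\<^esub>, a)) g"
    by (intro conjI; rule twisted_extension[OF g, where j = "\<lambda>m a. \<iota> (m, a)"])
      (auto simp: \<xi>_def cocycle_ext_def intro: inj)
  then show ?thesis by blast
qed

end

section \<open>The two maps between extension classes and cohomology classes\<close>

theorem theorem2p10:
  fixes K :: "('k, 'x) ring_scheme"
    and A :: "('k, 'a, 'y) trialg_scheme"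
    and M :: "('k, 'm, 'a, 'z) trirep_scheme"
    and \<iota> :: "'m \<times> 'a \<Rightarrow> 'e"
  assumes K: "field K"
    and A: "trias_algebra K A"
    and M: "trias_rep K A M"
    and universe: "inj_on \<iota> (carrier M \<times> carrier A)"
  shows
    "equiv (abelian_extensions K A M :: ('k, 'm, 'a, 'e) extn set) (ext_rel K A M) \<and>
     equiv (cocycles K A M 2) (cohomologous K A M 2) \<and>
     (\<forall>\<xi> \<in> (abelian_extensions K A M :: ('k, 'm, 'a, 'e) extn set).
        (\<exists>\<sigma>. linear_splitting K A \<xi> \<sigma>) \<and>
        (\<forall>\<sigma>. linear_splitting K A \<xi> \<sigma> \<longrightarrow>
           (\<exists>!f. describes_products K A M \<xi> \<sigma> f) \<and>
           ext_cocycle K A M \<xi> \<sigma> \<in> cocycles K A M 2)) \<and>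
     (\<forall>g \<in> cocycles K A M 2. cocycle_ext A M g \<in> abelian_extensions K A M) \<and>
     (\<exists>(\<Phi> :: ('k, 'm, 'a, 'e) extn set \<Rightarrow> (ptree \<times> 'a list \<Rightarrow> 'm) set) \<Psi>.
        \<Phi> \<in> Ext K A M \<rightarrow> cohomology K A M 2 \<and>
        \<Psi> \<in> cohomology K A M 2 \<rightarrow> Ext K A M \<and>
        (\<forall>\<xi> \<in> (abelian_extensions K A M :: ('k, 'm, 'a, 'e) extn set). \<forall>\<sigma>. linear_splitting K A \<xi> \<sigma> \<longrightarrow>
           \<Phi> (ext_class K A M \<xi>) = coh_class K A M 2 (ext_cocycle K A M \<xi> \<sigma>)) \<and>
        (\<forall>g \<in> cocycles K A M 2.
           \<Psi> (coh_class K A M 2 g) = ext_class K A M (cocycle_ext A M g)) \<and>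
        (\<forall>X \<in> Ext K A M. \<Psi> (\<Phi> X) = X) \<and>
        (\<forall>c \<in> cohomology K A M 2. \<Phi> (\<Psi> c) = c) \<and>
        bij_betw \<Phi> (Ext K A M) (cohomology K A M 2))"
proof -
  interpret trias_rep_data K A M by (rule trias_rep_data.intro[OF K A M])
  let ?AE = "abelian_extensions K A M :: ('k, 'm, 'a, 'e) extn set"
  let ?ER = "ext_rel K A M :: (('k, 'm, 'a, 'e) extn \<times> ('k, 'm, 'a, 'e) extn) set"
  let ?Z = "cocycles K A M 2" and ?R = "cohomologous K A M 2"
  have split: "\<exists>\<sigma>. linear_splitting K A \<xi> \<sigma>" if "\<xi> \<in> ?AE" for \<xi>
  proof -
    interpret abelian_extension K A M \<xi> by unfold_locales (fact that)
    show ?thesis by (rule splitting_exists)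
  qed
  have desc: "\<exists>!f. describes_products K A M \<xi> \<sigma> f"
      "describes_products K A M \<xi> \<sigma> (ext_cocycle K A M \<xi> \<sigma>)" "ext_cocycle K A M \<xi> \<sigma> \<in> ?Z"
    if "\<xi> \<in> ?AE" "linear_splitting K A \<xi> \<sigma>" for \<xi> \<sigma>
  proof -
    interpret split_extension K A M \<xi> \<sigma> by unfold_locales (fact that)+
    show "\<exists>!f. describes_products K A M \<xi> \<sigma> f" by (rule describes_products_exists)
    show "describes_products K A M \<xi> \<sigma> (ext_cocycle K A M \<xi> \<sigma>)" by (rule ext_cocycle_describes)
    then show "ext_cocycle K A M \<xi> \<sigma> \<in> ?Z" by (rule describes_products_cocycle)
  qed
  \<comment> \<open>One cocycle per extension, from an arbitrary splitting; by \<open>F_any\<close>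
    below every other splitting gives a cohomologous one.\<close>
  define F where "F \<xi> = ext_cocycle K A M \<xi> (SOME \<sigma>. linear_splitting K A \<xi> \<sigma>)"
    for \<xi> :: "('k, 'm, 'a, 'e) extn"
  have F_split: "linear_splitting K A \<xi> (SOME \<sigma>. linear_splitting K A \<xi> \<sigma>)" if "\<xi> \<in> ?AE" for \<xi>
    using split[OF that] by (rule someI_ex)
  have F: "F \<xi> \<in> ?Z" if "\<xi> \<in> ?AE" for \<xi>
    unfolding F_def using that F_split by (blast intro: desc)
  \<comment> \<open>The relation on extensions is the pullback of \<open>cohomologous\<close> along
    \<open>F\<close>, so its symmetry and transitivity come from the cocycles and no morphism has to
    be inverted.\<close>
  have rel_iff: "(\<xi>, \<xi>') \<in> ?ER \<longleftrightarrow> (F \<xi>, F \<xi>') \<in> ?R" if "\<xi> \<in> ?AE" "\<xi>' \<in> ?AE" for \<xi> \<xi>'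
    using that ext_equivalent_iff_cohomologous[OF that(1) F_split[OF that(1)] that(2)
        F_split[OF that(2)] desc(2)[OF that(1) F_split[OF that(1)]]
        desc(2)[OF that(2) F_split[OF that(2)]]]
    by (simp add: ext_rel_def F_def)
  have eqR: "equiv ?Z ?R" by (rule cohomologous_equiv)
  then have R: "refl_on ?Z ?R" "sym ?R" "trans ?R" by (auto simp: equiv_def)
  have eqE: "equiv ?AE ?ER"
  proof (rule equivI)
    show sub: "?ER \<subseteq> ?AE \<times> ?AE" by (auto simp: ext_rel_def)
    show "refl_on ?AE ?ER" using R(1) F by (auto simp: refl_on_def rel_iff)
    show "sym ?ER"
    proof (rule symI)
      fix x y assume "(x, y) \<in> ?ER"
      moreover from this sub have "x \<in> ?AE" "y \<in> ?AE" by auto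
      ultimately show "(y, x) \<in> ?ER" using R(2) by (auto simp: rel_iff dest: symD)
    qed
    show "trans ?ER"
    proof (rule transI)
      fix x y z assume "(x, y) \<in> ?ER" "(y, z) \<in> ?ER"
      moreover from this sub have "x \<in> ?AE" "y \<in> ?AE" "z \<in> ?AE" by auto
      ultimately show "(x, z) \<in> ?ER" using R(3) by (auto simp: rel_iff dest: transD)
    qed
  qed
  have class_eq: "ext_class K A M \<xi> = ?ER `` {\<xi>}" if "\<xi> \<in> ?AE" for \<xi>
    using that by (auto simp: ext_class_def ext_rel_def)
  have F_any: "(ext_cocycle K A M \<xi> \<sigma>, F \<xi>) \<in> ?R" if "\<xi> \<in> ?AE" "linear_splitting K A \<xi> \<sigma>" for \<xi> \<sigma>
  proof -
    have "(\<xi>, \<xi>) \<in> ?ER" using eqE that by (auto simp: equiv_def refl_on_def)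
    then have "ext_equivalent K M \<xi> \<xi>" by (simp add: ext_rel_def)
    with that ext_equivalent_iff_cohomologous[OF that that(1) F_split[OF that(1)] desc(2)[OF that]
        desc(2)[OF that(1) F_split[OF that(1)]]]
    show ?thesis by (simp add: F_def)
  qed
  \<comment> \<open>\<open>F\<close> meets every cohomology class, and the twisted product on pairs
    determines the same class in the universe as its transported copy \<xi>.\<close>
  have real: "\<exists>\<xi>\<in>?AE. (F \<xi>, g) \<in> ?R \<and> ext_class K A M (cocycle_ext A M g) = ?ER `` {\<xi>}"
    if g: "g \<in> ?Z" for g
  proof -
    obtain \<xi> :: "('k, 'm, 'a, 'e) extn" and \<sigma> where \<xi>: "\<xi> \<in> ?AE" "linear_splitting K A \<xi> \<sigma>"
      "describes_products K A M \<xi> \<sigma> g"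
      using cocycle_ext_in_universe[OF g universe] by blast
    \<comment> \<open>By uniqueness of the describing cochain, \<open>g\<close> is the cocycle of
      \<xi> for the splitting \<sigma>.\<close>
    then have "(g, F \<xi>) \<in> ?R" using F_any[OF \<xi>(1,2)] desc(1,2)[OF \<xi>(1,2)] by metis
    then have Fg: "(F \<xi>, g) \<in> ?R" using R(2) by (auto dest: symD)
    have "ext_equivalent K M (cocycle_ext A M g) \<xi>' \<longleftrightarrow> (\<xi>, \<xi>') \<in> ?ER" if "\<xi>' \<in> ?AE" for \<xi>'
    proof -
      have "ext_equivalent K M (cocycle_ext A M g) \<xi>' \<longleftrightarrow> (g, F \<xi>') \<in> ?R"
        unfolding F_def
        by (rule ext_equivalent_iff_cohomologous[OF cocycle_ext_extension(1,2)[OF g] that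
            F_split[OF that] cocycle_ext_extension(3)[OF g] desc(2)[OF that F_split[OF that]]])
      also have "\<dots> \<longleftrightarrow> (F \<xi>, F \<xi>') \<in> ?R" using Fg R(2,3) by (blast dest: symD transD)
      finally show ?thesis using rel_iff[OF \<xi>(1) that] by simp
    qed
    then have "ext_class K A M (cocycle_ext A M g) = ?ER `` {\<xi>}"
      by (auto simp: ext_class_def ext_rel_def)
    with \<xi>(1) Fg show ?thesis by blast
  qed
  \<comment> \<open>Both maps act on whole classes without choosing a representative: \<Phi>
    saturates the image under \<open>F\<close>, and \<Psi> takes the preimage.\<close>
  define \<Phi> where "\<Phi> X = ?R `` (F ` X)" for X
  define \<Psi> where "\<Psi> c = {\<xi> \<in> ?AE. F \<xi> \<in> c}" for c
  have \<Phi>: "\<Phi> (?ER `` {\<xi>}) = ?R `` {F \<xi>}" if \<xi>: "\<xi> \<in> ?AE" for \<xi>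
  proof -
    have "(F \<xi>, F \<xi>') \<in> ?R" if "(\<xi>, \<xi>') \<in> ?ER" for \<xi>'
      using that \<xi> rel_iff[of \<xi> \<xi>'] by (simp add: ext_rel_def)
    moreover have "(\<xi>, \<xi>) \<in> ?ER" using eqE \<xi> by (auto simp: equiv_def refl_on_def)
    ultimately show ?thesis unfolding \<Phi>_def using R(3) R(2) by (blast dest: transD symD)
  qed
  have \<Psi>: "\<Psi> (?R `` {F \<xi>}) = ?ER `` {\<xi>}" if "\<xi> \<in> ?AE" for \<xi>
    unfolding \<Psi>_def using that rel_iff by (auto simp: ext_rel_def)
  \<comment> \<open>With \<open>real\<close>, extensions index both sets of classes, and \<Phi> and
    \<Psi> match the class of \<xi> with that of \<open>F \<xi>\<close>. That they are mutually
    inverse is then immediate.\<close>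
  have coh: "c \<in> cohomology K A M 2 \<longleftrightarrow> (\<exists>\<xi>\<in>?AE. c = ?R `` {F \<xi>})" for c
  proof
    assume "c \<in> cohomology K A M 2"
    then obtain g where "g \<in> ?Z" "c = ?R `` {g}" by (auto simp: cohomology_def elim: quotientE)
    moreover from real[OF this(1)] obtain \<xi> where "\<xi> \<in> ?AE" "(F \<xi>, g) \<in> ?R" by blast
    ultimately show "\<exists>\<xi>\<in>?AE. c = ?R `` {F \<xi>}" using equiv_class_eq[OF eqR] by blast
  qed (auto simp: cohomology_def intro: quotientI F)
  have ext: "X \<in> Ext K A M \<longleftrightarrow> (\<exists>\<xi>\<in>?AE. X = ?ER `` {\<xi>})" for X
    by (auto simp: Ext_def intro: quotientI elim: quotientE)
  have maps: "\<Phi> \<in> Ext K A M \<rightarrow> cohomology K A M 2" "\<Psi> \<in> cohomology K A M 2 \<rightarrow> Ext K A M"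
    "\<forall>X\<in>Ext K A M. \<Psi> (\<Phi> X) = X" "\<forall>c\<in>cohomology K A M 2. \<Phi> (\<Psi> c) = c"
  proof -
    show "\<Phi> \<in> Ext K A M \<rightarrow> cohomology K A M 2"
      by (rule Pi_I, unfold coh ext, elim bexE, simp only: \<Phi>, blast)
    show "\<Psi> \<in> cohomology K A M 2 \<rightarrow> Ext K A M"
      by (rule Pi_I, unfold coh ext, elim bexE, simp only: \<Psi>, blast)
  qed (auto simp: coh ext \<Phi> \<Psi>)
  have bij: "bij_betw \<Phi> (Ext K A M) (cohomology K A M 2)"
    by (rule bij_betw_byWitness[where f' = \<Psi>]) (use maps in auto)
  have \<Phi>_class: "\<Phi> (ext_class K A M \<xi>) = coh_class K A M 2 (ext_cocycle K A M \<xi> \<sigma>)"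
    if "\<xi> \<in> ?AE" "linear_splitting K A \<xi> \<sigma>" for \<xi> \<sigma>
    using equiv_class_eq[OF eqR F_any[OF that]] that(1) by (simp add: class_eq \<Phi> coh_class_def)
  have \<Psi>_class: "\<Psi> (coh_class K A M 2 g) = ext_class K A M (cocycle_ext A M g)"
    if "g \<in> ?Z" for g
  proof -
    from real[OF that] obtain \<xi> where \<xi>: "\<xi> \<in> ?AE" "(F \<xi>, g) \<in> ?R"
      and cls: "ext_class K A M (cocycle_ext A M g) = ?ER `` {\<xi>}" by blast
    show ?thesis
      unfolding coh_class_def cls equiv_class_eq[OF eqR \<xi>(2), symmetric] by (rule \<Psi>[OF \<xi>(1)])
  qed
  show ?thesis
    by (intro conjI ballI allI impI exI[of _ \<Phi>] exI[of _ \<Psi>] eqE eqR split desc(1,3)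
        cocycle_ext_extension(1) bij \<Phi>_class \<Psi>_class maps(1,2) maps(3,4)[rule_format])
qed

end
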